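(* Let $\mathfrak X$ be a connective encoding structure on a poset $\mathcal P$, and let $M_0,\dots,M_n$ be a finite set of $\mathfrak X$-encodable persistence modules over $\mathcal P$. Then there exists a common $\mathfrak X$-encoding map $e\colon\mathcal P\to\mathcal P'$ of $M_0,\dots,M_n$ such that $e^*\colon\mathrm{Vect}^{\mathcal P'}\to\mathrm{Vect}^{\mathcal P}$ is fully faithful. In particular, the essential image $\mathcal I=e^*(\mathrm{Vect}^{\mathcal P'}_{\mathrm{fin}})$ is a full abelian subcategory of $\mathrm{Vect}^{\mathcal P}$ such that $M_0,\dots,M_n\in\mathcal I\subset\mathrm{PerM}_{\mathfrak X}(\mathcal P)$.
   Context: $\mathrm{Vect}$ is the category of vector spaces over a fixed field $\mathbb{F}$. For a poset $\mathcal P$, viewed as a category, $\mathrm{Vect}^{\mathcal P}$ is the category of functors $\mathcal P\to\mathrm{Vect}$ (persistence modules over $\mathcal P$), and $\mathrm{Vect}^{\mathcal P}_{\mathrm{fin}}$ its full subcategory of pointwise finite dimensional ones; for a poset map $e$, $e^*$ denotes precomposition with $e$. An interval in $\mathcal P$ is a subset $I$ such that $q\le p\le q'$ and $q,q'\in I$ imply $p\in I$. An encoding structure on $\mathcal P$ is a subset $\mathfrak X$ of the powerset of $\mathcal P$ such that: (1) $\mathfrak X$ is closed under finite unions and complements and contains $\mathcal P$; (2) if $I\in\mathfrak X$ is an interval, there are upsets $U,V\in\mathfrak X$ with $I=U\cap V^c$; (3) every element of $\mathfrak X$ is a finite union of intervals which are themselves in $\mathfrak X$. A poset is $\leq$-connected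 if any two elements are joined by a finite zigzag of comparable elements; the $\leq$-connected components of a poset are its maximal $\leq$-connected subsets (the equivalence classes of the relation "joined by a finite zigzag"). For a subset of a poset these notions refer to the induced order. $\mathfrak X$ is connective if every interval $I\in\mathfrak X$ has only finitely many $\leq$-connected components and these are also elements of $\mathfrak X$. An $\mathfrak X$-encoding map of a module $M\in\mathrm{Vect}^{\mathcal P}$ is a poset map $e\colon\mathcal P\to\mathcal P'$ with $\mathcal P'$ finite and all fibers in $\mathfrak X$, such that $M\cong e^*M'$ for some pointwise finite dimensional $M'\in\mathrm{Vect}^{\mathcal P'}$; it is a common $\mathfrak X$-encoding map of several modules if it is an $\mathfrak X$-encoding map of each of them. $M$ is $\mathfrak X$-encodable if it admits an $\mathfrak X$-encoding map. $\mathrm{PerM}_{\mathfrak X}(\mathcal P)$ is the full subcategory of $\mathrm{Vect}^{\mathcal P}$ on the $\mathfrak X$-encodable modules. Full abelian subcategory: a full additive subcategory $\mathcal B$ of an abelian category $\mathcal A$ such that the kernel and cokernel, taken in $\mathcal A$, of every morphism of $\mathcal B$ are (up to isomorphism) in $\mathcal B$; equivalently $\mathcal B$ is abelian and the inclusion is exact. *)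

theory Defs
  imports "Jordan_Normal_Form.Missing_VectorSpace"
begin

section \<open>Categories\<close>

text \<open>
  Hom sets are indexed by source and target and need not be disjoint. Therefore composition takes the
  three objects as arguments: \<open>Comp C a b c g f\<close> is the composite \<open>g \<circ> f\<close> of
  \<open>f \<in> Hom C a b\<close> and \<open>g \<in> Hom C b c\<close>.
\<close>

record ('o, 'm) cat =
  Obj :: "'o set"
  Hom :: "'o \<Rightarrow> 'o \<Rightarrow> 'm set"
  Ident :: "'o \<Rightarrow> 'm"
  Comp :: "'o \<Rightarrow> 'o \<Rightarrow> 'o \<Rightarrow> 'm \<Rightarrow> 'm \<Rightarrow> 'm"

locale category =
  fixes C :: "('o, 'm, 'z) cat_scheme"
  assumes ident_hom: "a \<in> Obj C \<Longrightarrow> Ident C a \<in> Hom C a a"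
    and comp_hom: "\<lbrakk>a \<in> Obj C; b \<in> Obj C; c \<in> Obj C; f \<in> Hom C a b; g \<in> Hom C b c\<rbrakk>
      \<Longrightarrow> Comp C a b c g f \<in> Hom C a c"
    and ident_left: "\<lbrakk>a \<in> Obj C; b \<in> Obj C; f \<in> Hom C a b\<rbrakk> \<Longrightarrow> Comp C a b b (Ident C b) f = f"
    and ident_right: "\<lbrakk>a \<in> Obj C; b \<in> Obj C; f \<in> Hom C a b\<rbrakk> \<Longrightarrow> Comp C a a b f (Ident C a) = f"
    and comp_assoc: "\<lbrakk>a \<in> Obj C; b \<in> Obj C; c \<in> Obj C; d \<in> Obj C;
        f \<in> Hom C a b; g \<in> Hom C b c; h \<in> Hom C c d\<rbrakk>
      \<Longrightarrow> Comp C a c d h (Comp C a b c g f) = Comp C a b d (Comp C b c d h g) f"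

definition isomorphic :: "('o, 'm, 'z) cat_scheme \<Rightarrow> 'o \<Rightarrow> 'o \<Rightarrow> bool" where
  "isomorphic C a b \<longleftrightarrow> (\<exists>f \<in> Hom C a b. \<exists>g \<in> Hom C b a.
     Comp C a b a g f = Ident C a \<and> Comp C b a b f g = Ident C b)"

definition is_monic :: "('o, 'm, 'z) cat_scheme \<Rightarrow> 'o \<Rightarrow> 'o \<Rightarrow> 'm \<Rightarrow> bool" where
  "is_monic C a b f \<longleftrightarrow> f \<in> Hom C a b \<and>
     (\<forall>c \<in> Obj C. \<forall>g \<in> Hom C c a. \<forall>h \<in> Hom C c a. Comp C c a b f g = Comp C c a b f h \<longrightarrow> g = h)"

definition is_epic :: "('o, 'm, 'z) cat_scheme \<Rightarrow> 'o \<Rightarrow> 'o \<Rightarrow> 'm \<Rightarrow> bool" where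
  "is_epic C a b f \<longleftrightarrow> f \<in> Hom C a b \<and>
     (\<forall>c \<in> Obj C. \<forall>g \<in> Hom C b c. \<forall>h \<in> Hom C b c. Comp C a b c g f = Comp C a b c h f \<longrightarrow> g = h)"

definition zero_object :: "('o, 'm, 'z) cat_scheme \<Rightarrow> 'o \<Rightarrow> bool" where
  "zero_object C z \<longleftrightarrow> z \<in> Obj C \<and>
     (\<forall>a \<in> Obj C. (\<exists>!f. f \<in> Hom C z a) \<and> (\<exists>!f. f \<in> Hom C a z))"


section \<open>Functors and functor categories\<close>

record ('a, 'm, 'b, 'n) cfunctor =
  Fob :: "'a \<Rightarrow> 'b"
  Fmor :: "'a \<Rightarrow> 'a \<Rightarrow> 'm \<Rightarrow> 'n"

definition is_functor ::
  "('a, 'm, 'y) cat_scheme \<Rightarrow> ('b, 'n, 'z) cat_scheme \<Rightarrow> ('a, 'm, 'b, 'n) cfunctor \<Rightarrow> bool" where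
  "is_functor C D F \<longleftrightarrow>
     (\<forall>x \<in> Obj C. Fob F x \<in> Obj D) \<and>
     (\<forall>x \<in> Obj C. \<forall>y \<in> Obj C. \<forall>f \<in> Hom C x y. Fmor F x y f \<in> Hom D (Fob F x) (Fob F y)) \<and>
     (\<forall>x \<in> Obj C. Fmor F x x (Ident C x) = Ident D (Fob F x)) \<and>
     (\<forall>x \<in> Obj C. \<forall>y \<in> Obj C. \<forall>z \<in> Obj C. \<forall>f \<in> Hom C x y. \<forall>g \<in> Hom C y z.
        Fmor F x z (Comp C x y z g f) =
        Comp D (Fob F x) (Fob F y) (Fob F z) (Fmor F y z g) (Fmor F x y f))"

definition fully_faithful ::
  "('a, 'm, 'y) cat_scheme \<Rightarrow> ('b, 'n, 'z) cat_scheme \<Rightarrow> ('a, 'm, 'b, 'n) cfunctor \<Rightarrow> bool" where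
  "fully_faithful C D F \<longleftrightarrow> is_functor C D F \<and>
     (\<forall>x \<in> Obj C. \<forall>y \<in> Obj C. bij_betw (Fmor F x y) (Hom C x y) (Hom D (Fob F x) (Fob F y)))"

definition comp_functor ::
  "('b, 'n, 'c, 'k) cfunctor \<Rightarrow> ('a, 'm, 'b, 'n) cfunctor \<Rightarrow> ('a, 'm, 'c, 'k) cfunctor" where
  "comp_functor F E = \<lparr>Fob = (\<lambda>x. Fob F (Fob E x)),
     Fmor = (\<lambda>x y f. Fmor F (Fob E x) (Fob E y) (Fmor E x y f))\<rparr>"

text \<open>The set of objects of the essential image of the full subcategory on \<open>S \<subseteq> Obj C\<close>.\<close>

definition essential_image ::
  "('b, 'n, 'z) cat_scheme \<Rightarrow> ('a, 'm, 'b, 'n) cfunctor \<Rightarrow> 'a set \<Rightarrow> 'b set" where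
  "essential_image D F S = {d \<in> Obj D. \<exists>c \<in> S. isomorphic D d (Fob F c)}"

text \<open>Natural transformations are extensional families, so that equality of morphisms is equality in HOL.\<close>

definition nat_trans ::
  "('a, 'm, 'y) cat_scheme \<Rightarrow> ('b, 'n, 'z) cat_scheme \<Rightarrow>
   ('a, 'm, 'b, 'n) cfunctor \<Rightarrow> ('a, 'm, 'b, 'n) cfunctor \<Rightarrow> ('a \<Rightarrow> 'n) set" where
  "nat_trans C D F G = {\<alpha> \<in> (\<Pi>\<^sub>E x \<in> Obj C. Hom D (Fob F x) (Fob G x)).
     \<forall>x \<in> Obj C. \<forall>y \<in> Obj C. \<forall>f \<in> Hom C x y.
       Comp D (Fob F x) (Fob F y) (Fob G y) (\<alpha> y) (Fmor F x y f) =
       Comp D (Fob F x) (Fob G x) (Fob G y) (Fmor G x y f) (\<alpha> x)}"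


section \<open>Abelian categories\<close>

record ('o, 'm) add_cat = "('o, 'm) cat" +
  HomAdd :: "'o \<Rightarrow> 'o \<Rightarrow> 'm \<Rightarrow> 'm \<Rightarrow> 'm"
  HomZero :: "'o \<Rightarrow> 'o \<Rightarrow> 'm"

definition hom_group :: "('o, 'm, 'z) add_cat_scheme \<Rightarrow> 'o \<Rightarrow> 'o \<Rightarrow> 'm monoid" where
  "hom_group C a b = \<lparr>carrier = Hom C a b, mult = HomAdd C a b, one = HomZero C a b\<rparr>"

locale preadditive_category = category C
  for C :: "('o, 'm, 'z) add_cat_scheme" +
  assumes hom_comm_group: "\<lbrakk>a \<in> Obj C; b \<in> Obj C\<rbrakk> \<Longrightarrow> comm_group (hom_group C a b)"
    and comp_add_left: "\<lbrakk>a \<in> Obj C; b \<in> Obj C; c \<in> Obj C; f \<in> Hom C a b; g \<in> Hom C b c; h \<in> Hom C b c\<rbrakk>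
      \<Longrightarrow> Comp C a b c (HomAdd C b c g h) f = HomAdd C a c (Comp C a b c g f) (Comp C a b c h f)"
    and comp_add_right: "\<lbrakk>a \<in> Obj C; b \<in> Obj C; c \<in> Obj C; f \<in> Hom C a b; g \<in> Hom C a b; h \<in> Hom C b c\<rbrakk>
      \<Longrightarrow> Comp C a b c h (HomAdd C a b f g) = HomAdd C a c (Comp C a b c h f) (Comp C a b c h g)"

definition is_biproduct :: "('o, 'm, 'z) add_cat_scheme \<Rightarrow> 'o \<Rightarrow> 'o \<Rightarrow> 'o \<Rightarrow> bool" where
  "is_biproduct C a b s \<longleftrightarrow> s \<in> Obj C \<and>
     (\<exists>i \<in> Hom C a s. \<exists>j \<in> Hom C b s. \<exists>p \<in> Hom C s a. \<exists>q \<in> Hom C s b.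
        Comp C a s a p i = Ident C a \<and> Comp C b s b q j = Ident C b \<and>
        Comp C a s b q i = HomZero C a b \<and> Comp C b s a p j = HomZero C b a \<and>
        HomAdd C s s (Comp C s a s i p) (Comp C s b s j q) = Ident C s)"

text \<open>\<open>\<kappa> : k \<rightarrow> a\<close> is a kernel of \<open>f : a \<rightarrow> b\<close>, respectively \<open>\<pi> : b \<rightarrow> q\<close> is a cokernel of it.\<close>

definition is_kernel :: "('o, 'm, 'z) add_cat_scheme \<Rightarrow> 'o \<Rightarrow> 'o \<Rightarrow> 'm \<Rightarrow> 'o \<Rightarrow> 'm \<Rightarrow> bool" where
  "is_kernel C a b f k \<kappa> \<longleftrightarrow> k \<in> Obj C \<and> \<kappa> \<in> Hom C k a \<and>
     Comp C k a b f \<kappa> = HomZero C k b \<and>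
     (\<forall>c \<in> Obj C. \<forall>h \<in> Hom C c a. Comp C c a b f h = HomZero C c b \<longrightarrow>
        (\<exists>!u. u \<in> Hom C c k \<and> Comp C c k a \<kappa> u = h))"

definition is_cokernel :: "('o, 'm, 'z) add_cat_scheme \<Rightarrow> 'o \<Rightarrow> 'o \<Rightarrow> 'm \<Rightarrow> 'o \<Rightarrow> 'm \<Rightarrow> bool" where
  "is_cokernel C a b f q \<pi> \<longleftrightarrow> q \<in> Obj C \<and> \<pi> \<in> Hom C b q \<and>
     Comp C a b q \<pi> f = HomZero C a q \<and>
     (\<forall>c \<in> Obj C. \<forall>h \<in> Hom C b c. Comp C a b c h f = HomZero C a c \<longrightarrow>
        (\<exists>!u. u \<in> Hom C q c \<and> Comp C b q c u \<pi> = h))"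

locale additive_category = preadditive_category C
  for C :: "('o, 'm, 'z) add_cat_scheme" +
  assumes ex_zero_object: "\<exists>z. zero_object C z"
    and ex_biproduct: "\<lbrakk>a \<in> Obj C; b \<in> Obj C\<rbrakk> \<Longrightarrow> \<exists>s. is_biproduct C a b s"

locale abelian_category = additive_category C
  for C :: "('o, 'm, 'z) add_cat_scheme" +
  assumes ex_kernel: "\<lbrakk>a \<in> Obj C; b \<in> Obj C; f \<in> Hom C a b\<rbrakk> \<Longrightarrow> \<exists>k \<kappa>. is_kernel C a b f k \<kappa>"
    and ex_cokernel: "\<lbrakk>a \<in> Obj C; b \<in> Obj C; f \<in> Hom C a b\<rbrakk> \<Longrightarrow> \<exists>q \<pi>. is_cokernel C a b f q \<pi>"
    and monic_normal: "\<lbrakk>a \<in> Obj C; b \<in> Obj C; is_monic C a b f\<rbrakk>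
      \<Longrightarrow> \<exists>c \<in> Obj C. \<exists>g \<in> Hom C b c. is_kernel C b c g a f"
    and epic_normal: "\<lbrakk>a \<in> Obj C; b \<in> Obj C; is_epic C a b f\<rbrakk>
      \<Longrightarrow> \<exists>c \<in> Obj C. \<exists>g \<in> Hom C c a. is_cokernel C c a g b f"

text \<open>A full subcategory is given by its set of objects.\<close>

definition full_subcategory :: "('o, 'm, 'z) add_cat_scheme \<Rightarrow> 'o set \<Rightarrow> ('o, 'm, 'z) add_cat_scheme" where
  "full_subcategory C B = C\<lparr>Obj := B\<rparr>"

text \<open>Kernels and cokernels are formed in the ambient category; being unique up to isomorphism, they lie
  in \<open>B\<close> up to isomorphism iff one choice of them has its object in \<open>B\<close>.\<close>

definition full_abelian_subcategory :: "('o, 'm, 'z) add_cat_scheme \<Rightarrow> 'o set \<Rightarrow> bool" where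
  "full_abelian_subcategory A B \<longleftrightarrow>
     abelian_category A \<and> B \<subseteq> Obj A \<and> additive_category (full_subcategory A B) \<and>
     (\<forall>a \<in> B. \<forall>b \<in> B. \<forall>f \<in> Hom A a b.
        (\<exists>k \<in> B. \<exists>\<kappa>. is_kernel A a b f k \<kappa>) \<and> (\<exists>q \<in> B. \<exists>\<pi>. is_cokernel A a b f q \<pi>))"

definition functor_category ::
  "('a, 'm, 'y) cat_scheme \<Rightarrow> ('b, 'n, 'z) add_cat_scheme \<Rightarrow>
   (('a, 'm, 'b, 'n) cfunctor, 'a \<Rightarrow> 'n) add_cat" where
  "functor_category C D =
    \<lparr>Obj = {F. is_functor C D F},
     Hom = nat_trans C D,
     Ident = (\<lambda>F. \<lambda>x \<in> Obj C. Ident D (Fob F x)),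
     Comp = (\<lambda>F G H \<beta> \<alpha>. \<lambda>x \<in> Obj C. Comp D (Fob F x) (Fob G x) (Fob H x) (\<beta> x) (\<alpha> x)),
     HomAdd = (\<lambda>F G \<alpha> \<beta>. \<lambda>x \<in> Obj C. HomAdd D (Fob F x) (Fob G x) (\<alpha> x) (\<beta> x)),
     HomZero = (\<lambda>F G. \<lambda>x \<in> Obj C. HomZero D (Fob F x) (Fob G x))\<rparr>"

text \<open>Precomposition with \<open>E : C \<rightarrow> C'\<close>, as a functor from functors on \<open>C'\<close> to functors on \<open>C\<close>.\<close>

definition precomp_functor ::
  "('a, 'm, 'y) cat_scheme \<Rightarrow> ('a, 'm, 'c, 'k) cfunctor \<Rightarrow>
   (('c, 'k, 'b, 'n) cfunctor, 'c \<Rightarrow> 'n, ('a, 'm, 'b, 'n) cfunctor, 'a \<Rightarrow> 'n) cfunctor" where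
  "precomp_functor C E =
    \<lparr>Fob = (\<lambda>F. comp_functor F E), Fmor = (\<lambda>F G \<alpha>. \<lambda>x \<in> Obj C. \<alpha> (Fob E x))\<rparr>"


section \<open>Persistence modules\<close>

text \<open>
  Vector spaces over the field \<open>K\<close> have their carrier inside the type \<open>'v\<close>, which plays the role of the
  universe of sets. As soon as \<open>'v\<close> is infinite, this category has all finite direct sums and quotients
  up to isomorphism. Linear maps are extensional, so that equality of morphisms is equality in HOL.
\<close>

definition vect :: "('k, 'r) ring_scheme \<Rightarrow> (('k, 'v) module, 'v \<Rightarrow> 'v) add_cat" where
  "vect K =
    \<lparr>Obj = {V. vectorspace K V},
     Hom = (\<lambda>V W. module_hom K V W \<inter> extensional (carrier V)),
     Ident = (\<lambda>V. \<lambda>v \<in> carrier V. v),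
     Comp = (\<lambda>U V W g f. compose (carrier U) g f),
     HomAdd = (\<lambda>V W f g. \<lambda>v \<in> carrier V. f v \<oplus>\<^bsub>W\<^esub> g v),
     HomZero = (\<lambda>V W. \<lambda>v \<in> carrier V. \<zero>\<^bsub>W\<^esub>)\<rparr>"

text \<open>
  A poset is represented by its order relation \<open>P\<close> with \<^term>\<open>Partial_order P\<close>. By reflexivity its
  underlying set, possibly empty, is \<^term>\<open>Field P\<close>.
\<close>

definition poset_category :: "'p rel \<Rightarrow> ('p, unit) cat" where
  "poset_category P =
    \<lparr>Obj = Field P, Hom = (\<lambda>p q. if (p, q) \<in> P then {()} else {}),
     Ident = (\<lambda>_. ()), Comp = (\<lambda>_ _ _ _ _. ())\<rparr>"

definition poset_map :: "'p rel \<Rightarrow> 'q rel \<Rightarrow> ('p \<Rightarrow> 'q) \<Rightarrow> bool" where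
  "poset_map P Q e \<longleftrightarrow> e \<in> Field P \<rightarrow> Field Q \<and> (\<forall>p q. (p, q) \<in> P \<longrightarrow> (e p, e q) \<in> Q)"

definition poset_functor :: "('p \<Rightarrow> 'q) \<Rightarrow> ('p, unit, 'q, unit) cfunctor" where
  "poset_functor e = \<lparr>Fob = e, Fmor = (\<lambda>_ _ _. ())\<rparr>"

type_synonym ('p, 'k, 'v) pers_module = "('p, unit, ('k, 'v) module, 'v \<Rightarrow> 'v) cfunctor"

definition pers_category ::
  "('k, 'r) ring_scheme \<Rightarrow> 'p rel \<Rightarrow> (('p, 'k, 'v) pers_module, 'p \<Rightarrow> 'v \<Rightarrow> 'v) add_cat" where
  "pers_category K P = functor_category (poset_category P) (vect K)"

definition pfd_modules :: "('k, 'r) ring_scheme \<Rightarrow> 'p rel \<Rightarrow> ('p, 'k, 'v) pers_module set" where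
  "pfd_modules K P =
     {M \<in> Obj (pers_category K P). \<forall>p \<in> Field P. vectorspace.fin_dim K (Fob M p)}"

definition pullback ::
  "'p rel \<Rightarrow> ('p \<Rightarrow> 'q) \<Rightarrow>
   (('q, 'k, 'v) pers_module, 'q \<Rightarrow> 'v \<Rightarrow> 'v, ('p, 'k, 'v) pers_module, 'p \<Rightarrow> 'v \<Rightarrow> 'v) cfunctor" where
  "pullback P e = precomp_functor (poset_category P) (poset_functor e)"


section \<open>Encoding structures\<close>

definition interval_in :: "'p rel \<Rightarrow> 'p set \<Rightarrow> bool" where
  "interval_in P I \<longleftrightarrow> I \<subseteq> Field P \<and>
     (\<forall>q \<in> I. \<forall>q' \<in> I. \<forall>p. (q, p) \<in> P \<and> (p, q') \<in> P \<longrightarrow> p \<in> I)"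

definition upset_in :: "'p rel \<Rightarrow> 'p set \<Rightarrow> bool" where
  "upset_in P U \<longleftrightarrow> U \<subseteq> Field P \<and> (\<forall>p \<in> U. \<forall>q. (p, q) \<in> P \<longrightarrow> q \<in> U)"

definition encoding_structure :: "'p rel \<Rightarrow> 'p set set \<Rightarrow> bool" where
  "encoding_structure P X \<longleftrightarrow> X \<subseteq> Pow (Field P) \<and>
     (\<forall>\<F>. finite \<F> \<and> \<F> \<subseteq> X \<longrightarrow> \<Union>\<F> \<in> X) \<and>
     (\<forall>S \<in> X. Field P - S \<in> X) \<and>
     Field P \<in> X \<and>
     (\<forall>I \<in> X. interval_in P I \<longrightarrow>
        (\<exists>U \<in> X. \<exists>V \<in> X. upset_in P U \<and> upset_in P V \<and> I = U \<inter> (Field P - V))) \<and>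
     (\<forall>S \<in> X. \<exists>\<F>. finite \<F> \<and> \<F> \<subseteq> X \<and> (\<forall>I \<in> \<F>. interval_in P I) \<and> S = \<Union>\<F>)"

text \<open>Two elements of \<open>S\<close> are related iff they are joined by a finite zigzag of comparable elements of \<open>S\<close>.\<close>

definition zigzag_rel :: "'p rel \<Rightarrow> 'p set \<Rightarrow> 'p rel" where
  "zigzag_rel P S = ((P \<union> P\<inverse>) \<inter> S \<times> S)\<^sup>* \<inter> S \<times> S"

definition connected_components_of_poset :: "'p rel \<Rightarrow> 'p set \<Rightarrow> 'p set set" where
  "connected_components_of_poset P S = S // zigzag_rel P S"

definition connective :: "'p rel \<Rightarrow> 'p set set \<Rightarrow> bool" where
  "connective P X \<longleftrightarrow> (\<forall>I \<in> X. interval_in P I \<longrightarrow>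
     finite (connected_components_of_poset P I) \<and> connected_components_of_poset P I \<subseteq> X)"

definition encoding_map ::
  "('k, 'r) ring_scheme \<Rightarrow> 'p rel \<Rightarrow> 'p set set \<Rightarrow> ('p, 'k, 'v) pers_module \<Rightarrow>
   'q rel \<Rightarrow> ('p \<Rightarrow> 'q) \<Rightarrow> bool" where
  "encoding_map K P X M P' e \<longleftrightarrow>
     Partial_order P' \<and> finite (Field P') \<and> poset_map P P' e \<and>
     (\<forall>x \<in> Field P'. {p \<in> Field P. e p = x} \<in> X) \<and>
     (\<exists>M' \<in> pfd_modules K P'. isomorphic (pers_category K P) M (Fob (pullback P e) M'))"

text \<open>Every finite poset is isomorphic to one whose elements are natural numbers, so it suffices to let
  the finite target poset range over these. \<open>encodable_modules K P X\<close> is the set of objects of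
  \<open>PerM\<^sub>X(P)\<close>.\<close>

definition encodable_modules ::
  "('k, 'r) ring_scheme \<Rightarrow> 'p rel \<Rightarrow> 'p set set \<Rightarrow> ('p, 'k, 'v) pers_module set" where
  "encodable_modules K P X =
     {M \<in> Obj (pers_category K P). \<exists>(P' :: nat rel) e. encoding_map K P X M P' e}"

end

(*
  Take the common refinement of the given encoding maps and split each of its fibers, an interval in X, into its
  finitely many connected components. The components, with the order generated by that of P, form a finite poset P':
  a cycle of components lies over a single point, hence is constant. Every module encoded by one of the given
  maps is a pullback along e : P \<rightarrow> P'. As the structure maps of a pullback along a fiber are identities, a natural
  transformation of pullbacks is constant on connected fibers and thus descends to P'; naturality need only be
  checked on generators of the order. Kernels, cokernels and direct sums are computed pointwise, so e* preserves
  them, and fullness of e* makes its essential image closed under them.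
*)

theory Submission
  imports Defs
begin

section \<open>Vector spaces\<close>

text \<open>Pullback along the product of the given maps can fail to be full for two reasons. A
  transformation may take unrelated values on two connected components of the same fiber, and the
  order of the target may relate images of elements that no chain of comparable elements and fiber
  changes links, so naturality along that relation does not follow from naturality over
  \<open>P\<close>. Splitting the fibers removes the first obstacle; replacing the target order by
  the transitive closure of the image of \<open>P\<close> removes the second, at the price that
  antisymmetry has to be proved. Since a component lies in one fiber of every given map, each of
  these maps still factors through \<open>e\<close>. All vector spaces must stay inside the type
  \<open>'v\<close>. A quotient is therefore carried by chosen coset representatives, and a direct
  sum is moved from \<open>'v \<times> 'v\<close> back to \<open>'v\<close> by a bijection of these
  types. This bijection is the reason for taking \<open>'v\<close> infinite.\<close>

lemma vect_hom_iff:
  "f \<in> Hom (vect K) V W \<longleftrightarrow> f \<in> extensional (carrier V) \<and> (\<forall>v \<in> carrier V. f v \<in> carrier W) \<and>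
    (\<forall>u \<in> carrier V. \<forall>v \<in> carrier V. f (u \<oplus>\<^bsub>V\<^esub> v) = f u \<oplus>\<^bsub>W\<^esub> f v) \<and>
    (\<forall>c \<in> carrier K. \<forall>v \<in> carrier V. f (c \<odot>\<^bsub>V\<^esub> v) = c \<odot>\<^bsub>W\<^esub> f v)"
  by (auto simp: vect_def module_hom_def)

lemma vect_homD:
  assumes "f \<in> Hom (vect K) V W"
  shows "f \<in> extensional (carrier V)"
    and "v \<in> carrier V \<Longrightarrow> f v \<in> carrier W"
    and "\<lbrakk>u \<in> carrier V; v \<in> carrier V\<rbrakk> \<Longrightarrow> f (u \<oplus>\<^bsub>V\<^esub> v) = f u \<oplus>\<^bsub>W\<^esub> f v"
    and "\<lbrakk>c \<in> carrier K; v \<in> carrier V\<rbrakk> \<Longrightarrow> f (c \<odot>\<^bsub>V\<^esub> v) = c \<odot>\<^bsub>W\<^esub> f v"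
  using assms by (auto simp: vect_hom_iff)

lemma vect_hom_linear_map:
  assumes "f \<in> Hom (vect K) V W" "vectorspace K V" "vectorspace K W"
  shows "linear_map K V W f"
  using assms
  by (auto simp: linear_map_def mod_hom_def mod_hom_axioms_def vectorspace_def vect_def)

lemma vect_hom_zero:
  assumes "f \<in> Hom (vect K) V W" "vectorspace K V" "vectorspace K W"
  shows "f \<zero>\<^bsub>V\<^esub> = \<zero>\<^bsub>W\<^esub>"
  by (rule linear_map.T0_is_0[OF vect_hom_linear_map[OF assms]])

lemma vect_hom_minus:
  assumes "f \<in> Hom (vect K) V W" "vectorspace K V" "vectorspace K W" "u \<in> carrier V" "v \<in> carrier V"
  shows "f (u \<ominus>\<^bsub>V\<^esub> v) = f u \<ominus>\<^bsub>W\<^esub> f v"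
  using linear_map.T_minus[OF vect_hom_linear_map[OF assms(1-3)]] assms(4,5) by blast

lemma vs_zero_closed: "vectorspace K V \<Longrightarrow> \<zero>\<^bsub>V\<^esub> \<in> carrier V"
  by (meson abelian_group.axioms(1) abelian_monoid.zero_closed module.axioms(2) vectorspace.axioms(1))

lemma vs_abelian: "vectorspace K V \<Longrightarrow> abelian_group V"
  by (meson module.axioms(2) vectorspace.axioms(1))

lemma vs_module: "vectorspace K V \<Longrightarrow> module K V"
  by (simp add: vectorspace_def)

lemma vs_smult_zero: "vectorspace K V \<Longrightarrow> c \<in> carrier K \<Longrightarrow> c \<odot>\<^bsub>V\<^esub> \<zero>\<^bsub>V\<^esub> = \<zero>\<^bsub>V\<^esub>"
  by (rule module.rmult_0[OF vs_module])

lemma vs_add_closed: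
  "\<lbrakk>vectorspace K V; u \<in> carrier V; v \<in> carrier V\<rbrakk> \<Longrightarrow> u \<oplus>\<^bsub>V\<^esub> v \<in> carrier V"
  by (simp add: abelian_group.axioms(1) abelian_monoid.a_closed vs_abelian)

lemma vs_smult_closed:
  "\<lbrakk>vectorspace K V; c \<in> carrier K; v \<in> carrier V\<rbrakk> \<Longrightarrow> c \<odot>\<^bsub>V\<^esub> v \<in> carrier V"
  by (rule module.smult_closed[OF vs_module])

text \<open>Transport of structure along \<open>r\<close>, which is either injective (a copy of \<open>V\<close> in another type) or
  picks representatives of the cosets of a subspace (the quotient of \<open>V\<close> by it).\<close>

definition image_space :: "('k, 'v) module \<Rightarrow> ('v \<Rightarrow> 'w) \<Rightarrow> ('k, 'w) module" where
  "image_space V r = \<lparr>carrier = r ` carrier V, mult = (\<lambda>_ _. r \<zero>\<^bsub>V\<^esub>), one = r \<zero>\<^bsub>V\<^esub>, zero = r \<zero>\<^bsub>V\<^esub>,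
     add = (\<lambda>s t. r (inv_into (carrier V) r s \<oplus>\<^bsub>V\<^esub> inv_into (carrier V) r t)),
     smult = (\<lambda>c s. r (c \<odot>\<^bsub>V\<^esub> inv_into (carrier V) r s))\<rparr>"

text \<open>\<open>image_space\<close> computes with arbitrary preimages picked by
  \<open>inv_into\<close>. This is the condition that makes its sums and scalar multiples
  independent of the pick.\<close>

definition linear_congruence :: "('k, 'r) ring_scheme \<Rightarrow> ('k, 'v) module \<Rightarrow> ('v \<Rightarrow> 'w) \<Rightarrow> bool" where
  "linear_congruence K V r \<longleftrightarrow>
     (\<forall>u \<in> carrier V. \<forall>u' \<in> carrier V. \<forall>v \<in> carrier V. \<forall>v' \<in> carrier V.
        r u = r u' \<longrightarrow> r v = r v' \<longrightarrow> r (u \<oplus>\<^bsub>V\<^esub> v) = r (u' \<oplus>\<^bsub>V\<^esub> v')) \<and>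
     (\<forall>c \<in> carrier K. \<forall>v \<in> carrier V. \<forall>v' \<in> carrier V. r v = r v' \<longrightarrow> r (c \<odot>\<^bsub>V\<^esub> v) = r (c \<odot>\<^bsub>V\<^esub> v'))"

lemma inj_linear_congruence: "inj_on r (carrier V) \<Longrightarrow> linear_congruence K V r"
  by (auto simp: linear_congruence_def dest: inj_onD)

lemma image_space_carrier [simp]: "carrier (image_space V r) = r ` carrier V"
  and image_space_zero [simp]: "\<zero>\<^bsub>image_space V r\<^esub> = r \<zero>\<^bsub>V\<^esub>"
  by (simp_all add: image_space_def)

lemma image_space_add:
  assumes "linear_congruence K V r" "u \<in> carrier V" "v \<in> carrier V"
  shows "r u \<oplus>\<^bsub>image_space V r\<^esub> r v = r (u \<oplus>\<^bsub>V\<^esub> v)"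
proof -
  have *: "inv_into (carrier V) r (r x) \<in> carrier V \<and> r (inv_into (carrier V) r (r x)) = r x"
    if "x \<in> carrier V" for x
    using that by (simp add: f_inv_into_f inv_into_into)
  have "r (inv_into (carrier V) r (r u) \<oplus>\<^bsub>V\<^esub> inv_into (carrier V) r (r v)) = r (u \<oplus>\<^bsub>V\<^esub> v)"
    using assms *[OF assms(2)] *[OF assms(3)] unfolding linear_congruence_def by blast
  then show ?thesis by (simp add: image_space_def)
qed

lemma image_space_smult:
  assumes "linear_congruence K V r" "c \<in> carrier K" "v \<in> carrier V"
  shows "c \<odot>\<^bsub>image_space V r\<^esub> r v = r (c \<odot>\<^bsub>V\<^esub> v)"
proof -
  have *: "inv_into (carrier V) r (r v) \<in> carrier V \<and> r (inv_into (carrier V) r (r v)) = r v"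
    using assms(3) by (simp add: f_inv_into_f inv_into_into)
  have "r (c \<odot>\<^bsub>V\<^esub> inv_into (carrier V) r (r v)) = r (c \<odot>\<^bsub>V\<^esub> v)"
    using assms * unfolding linear_congruence_def by blast
  then show ?thesis by (simp add: image_space_def)
qed

lemma image_space_vectorspace:
  fixes V :: "('k, 'v) module" and r :: "'v \<Rightarrow> 'w"
  assumes V: "vectorspace K V" and r: "linear_congruence K V r"
  shows "vectorspace K (image_space V r)"
proof -
  interpret V: vectorspace K V by fact
  note [simp] = image_space_add[OF r] image_space_smult[OF r]
  have "module K (image_space V r)"
  proof (rule module_criteria)
    show "\<forall>v\<in>carrier (image_space V r). \<exists>w\<in>carrier (image_space V r).
        v \<oplus>\<^bsub>image_space V r\<^esub> w = \<zero>\<^bsub>image_space V r\<^esub>"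
    proof
      fix s assume "s \<in> carrier (image_space V r)"
      then obtain v where "v \<in> carrier V" "s = r v" by auto
      then show "\<exists>w\<in>carrier (image_space V r). s \<oplus>\<^bsub>image_space V r\<^esub> w = \<zero>\<^bsub>image_space V r\<^esub>"
        by (auto intro!: bexI[of _ "\<ominus>\<^bsub>V\<^esub> v"] simp: V.M.r_neg)
    qed
  qed (auto simp: V.M.a_ac V.smult_l_distr V.smult_r_distr V.smult_assoc1 V.R.is_cring)
  then show ?thesis
    by (simp add: vectorspace_def V.field_axioms)
qed

text \<open>The quotient of \<open>V\<close> by the range of \<open>f\<close> is modelled without
  leaving the type \<open>'v\<close>: a coset is replaced by one chosen element of it, so equality
  of representatives is equality of cosets.\<close>

lemma ex_coset_representatives:
  fixes U V :: "('k, 'v) module"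
  assumes "vectorspace K U" "vectorspace K V" "f \<in> Hom (vect K) U V"
  shows "\<exists>r :: 'v \<Rightarrow> 'v. \<forall>u \<in> carrier V. \<forall>v \<in> carrier V. r u = r v \<longleftrightarrow> u \<ominus>\<^bsub>V\<^esub> v \<in> f ` carrier U"
    (is "\<exists>r. \<forall>u \<in> _. \<forall>v \<in> _. r u = r v \<longleftrightarrow> ?R u v")
proof -
  interpret GU: abelian_group U using assms(1) by (rule vs_abelian)
  interpret GV: abelian_group V using assms(2) by (rule vs_abelian)
  interpret linear_map K U V f by (rule vect_hom_linear_map) fact+
  have neg: "\<ominus>\<^bsub>V\<^esub> x \<in> f ` carrier U" if x: "x \<in> f ` carrier U" for x
  proof -
    obtain y where "y \<in> carrier U" "x = f y" using x by blast
    then have "\<ominus>\<^bsub>V\<^esub> x = f (\<ominus>\<^bsub>U\<^esub> y)" "\<ominus>\<^bsub>U\<^esub> y \<in> carrier U" by simp_all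
    then show ?thesis by (rule image_eqI)
  qed
  have add: "x \<oplus>\<^bsub>V\<^esub> y \<in> f ` carrier U" if "x \<in> f ` carrier U" "y \<in> f ` carrier U" for x y
  proof -
    obtain x' y' where "x' \<in> carrier U" "x = f x'" "y' \<in> carrier U" "y = f y'" using \<open>x \<in> _\<close> \<open>y \<in> _\<close> by blast
    then have "x \<oplus>\<^bsub>V\<^esub> y = f (x' \<oplus>\<^bsub>U\<^esub> y')" "x' \<oplus>\<^bsub>U\<^esub> y' \<in> carrier U" by simp_all
    then show ?thesis by (rule image_eqI)
  qed
  have refl: "?R u u" if "u \<in> carrier V" for u
  proof -
    have "u \<ominus>\<^bsub>V\<^esub> u = f \<zero>\<^bsub>U\<^esub>" "\<zero>\<^bsub>U\<^esub> \<in> carrier U" using that by (simp_all add: GV.minus_eq GV.r_neg)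
    then show ?thesis by (rule image_eqI)
  qed
  have sym: "?R v u" if "u \<in> carrier V" "v \<in> carrier V" "?R u v" for u v
  proof -
    have "v \<ominus>\<^bsub>V\<^esub> u = \<ominus>\<^bsub>V\<^esub> (u \<ominus>\<^bsub>V\<^esub> v)"
      using that by (simp add: GV.minus_eq GV.minus_add GV.a_comm)
    then show ?thesis using neg[OF that(3)] by simp
  qed
  have trans: "?R u w" if "u \<in> carrier V" "v \<in> carrier V" "w \<in> carrier V" "?R u v" "?R v w" for u v w
  proof -
    have "u \<ominus>\<^bsub>V\<^esub> w = (u \<ominus>\<^bsub>V\<^esub> v) \<oplus>\<^bsub>V\<^esub> (v \<ominus>\<^bsub>V\<^esub> w)"
      using that by (simp add: GV.minus_eq GV.a_ac GV.r_neg1 GV.r_neg2)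
    then show ?thesis using add[OF that(4,5)] by simp
  qed
  define r where "r u = (SOME w. w \<in> carrier V \<and> ?R u w)" for u
  have r: "r u \<in> carrier V \<and> ?R u (r u)" if "u \<in> carrier V" for u
    unfolding r_def by (rule someI[of _ u]) (use that refl in auto)
  have "r u = r v \<longleftrightarrow> ?R u v" if uv: "u \<in> carrier V" "v \<in> carrier V" for u v
  proof
    assume "r u = r v"
    then show "?R u v" using r[OF uv(1)] r[OF uv(2)] uv sym trans by metis
  next
    assume "?R u v"
    then have "?R u w \<longleftrightarrow> ?R v w" if "w \<in> carrier V" for w
      using that uv sym trans by metis
    \<comment> \<open>Elements of the same coset hand \<open>SOME\<close> the same predicate, hence
      receive literally the same representative.\<close>
    then show "r u = r v" unfolding r_def by (metis (lifting))
  qed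
  then show ?thesis by blast
qed

text \<open>Changing representatives changes a sum by \<open>f a\<close> plus \<open>f b\<close>,
  which is \<open>f\<close> of a sum, and a scalar multiple by \<open>c\<close> times
  \<open>f b\<close>, again in the range of \<open>f\<close>.\<close>

lemma coset_linear_congruence:
  assumes "vectorspace K U" "vectorspace K V" "f \<in> Hom (vect K) U V"
    and r: "\<forall>u \<in> carrier V. \<forall>v \<in> carrier V. r u = r v \<longleftrightarrow> u \<ominus>\<^bsub>V\<^esub> v \<in> f ` carrier U"
  shows "linear_congruence K V r"
proof -
  interpret GU: abelian_group U using assms(1) by (rule vs_abelian)
  interpret GV: abelian_group V using assms(2) by (rule vs_abelian)
  interpret linear_map K U V f by (rule vect_hom_linear_map) fact+
  have "(u \<oplus>\<^bsub>V\<^esub> v) \<ominus>\<^bsub>V\<^esub> (u' \<oplus>\<^bsub>V\<^esub> v') \<in> f ` carrier U"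
    if "u \<in> carrier V" "u' \<in> carrier V" "v \<in> carrier V" "v' \<in> carrier V"
      "u \<ominus>\<^bsub>V\<^esub> u' \<in> f ` carrier U" "v \<ominus>\<^bsub>V\<^esub> v' \<in> f ` carrier U" for u u' v v'
  proof -
    from that obtain a b where ab: "a \<in> carrier U" "b \<in> carrier U" "u \<ominus>\<^bsub>V\<^esub> u' = f a" "v \<ominus>\<^bsub>V\<^esub> v' = f b"
      by auto
    have "(u \<oplus>\<^bsub>V\<^esub> v) \<ominus>\<^bsub>V\<^esub> (u' \<oplus>\<^bsub>V\<^esub> v') = (u \<ominus>\<^bsub>V\<^esub> u') \<oplus>\<^bsub>V\<^esub> (v \<ominus>\<^bsub>V\<^esub> v')"
      using that by (simp add: GV.minus_eq GV.a_ac GV.minus_add)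
    also have "\<dots> = f (a \<oplus>\<^bsub>U\<^esub> b)" using ab by simp
    finally show ?thesis using ab GU.a_closed by (metis image_eqI)
  qed
  moreover have "c \<odot>\<^bsub>V\<^esub> v \<ominus>\<^bsub>V\<^esub> c \<odot>\<^bsub>V\<^esub> v' \<in> f ` carrier U"
    if "c \<in> carrier K" "v \<in> carrier V" "v' \<in> carrier V" "v \<ominus>\<^bsub>V\<^esub> v' \<in> f ` carrier U" for c v v'
  proof -
    from that obtain b where b: "b \<in> carrier U" "v \<ominus>\<^bsub>V\<^esub> v' = f b"
      by auto
    have "c \<odot>\<^bsub>V\<^esub> v \<ominus>\<^bsub>V\<^esub> c \<odot>\<^bsub>V\<^esub> v' = c \<odot>\<^bsub>V\<^esub> (v \<ominus>\<^bsub>V\<^esub> v')"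
      using that by (simp add: GV.minus_eq module.smult_r_distr module.smult_r_minus)
    also have "\<dots> = f (c \<odot>\<^bsub>U\<^esub> b)" using b that by simp
    finally show ?thesis using b that vs_smult_closed[OF assms(1)] by (metis image_eqI)
  qed
  ultimately show ?thesis
    using r unfolding linear_congruence_def by (auto simp: GV.a_closed module.smult_closed)
qed

text \<open>A linearly independent subset of \<open>W\<close> stays independent in \<open>V\<close>,
  so its size is at most the dimension of \<open>V\<close>. Hence a maximal independent subset of
  \<open>W\<close> exists, and it is a finite basis.\<close>

lemma subspace_fin_dim:
  assumes V: "vectorspace K V" and fd: "vectorspace.fin_dim K V" and W: "subspace K W V"
  shows "vectorspace.fin_dim K (V\<lparr>carrier := W\<rparr>)"
proof -
  interpret V: vectorspace K V by fact
  interpret W: vectorspace K "V\<lparr>carrier := W\<rparr>" by (rule V.subspace_is_vs[OF W])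
  have sub: "submodule K W V" using W by (simp add: subspace_def)
  have WV: "W \<subseteq> carrier V" using sub by (simp add: submodule_def)
  have *: "finite A \<and> card A \<le> V.dim" if "A \<subseteq> W" "W.lin_indpt A" for A
  proof -
    have "V.lin_indpt A" using V.span_li_not_depend(2)[OF that(1) sub] that(2) by simp
    then show ?thesis using V.li_le_dim[OF fd] that WV by blast
  qed
  have "\<exists>A. finite A \<and> maximal A (\<lambda>S. S \<subseteq> carrier (V\<lparr>carrier := W\<rparr>) \<and> W.lin_indpt S)"
  proof (rule maximal_exists)
    show "{} \<subseteq> carrier (V\<lparr>carrier := W\<rparr>) \<and> W.lin_indpt {}"
      by (auto simp: W.lin_dep_def)
  qed (use * in auto)
  then obtain A where A: "finite A" "W.basis A"
    using W.max_li_is_basis by blast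
  then show ?thesis
    unfolding W.fin_dim_def W.basis_def by blast
qed

text \<open>The images of finite spanning sets of \<open>V\<close> and \<open>W\<close> together
  span \<open>D\<close>.\<close>

lemma sum_fin_dim:
  fixes V W D :: "('k, 'v) module"
  assumes VWD: "vectorspace K V" "vectorspace K W" "vectorspace K D"
    and fd: "vectorspace.fin_dim K V" "vectorspace.fin_dim K W"
    and i: "i \<in> Hom (vect K) V D" and j: "j \<in> Hom (vect K) W D"
    and D: "\<And>d. d \<in> carrier D \<Longrightarrow> \<exists>v \<in> carrier V. \<exists>w \<in> carrier W. d = i v \<oplus>\<^bsub>D\<^esub> j w"
  shows "vectorspace.fin_dim K D"
proof -
  interpret D: vectorspace K D by fact
  \<comment> \<open>The preimage of the span of \<open>B\<close> is a submodule of \<open>V\<close>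
    that contains the spanning set \<open>A\<close>, so it is all of \<open>V\<close>.\<close>
  have *: "i ` carrier V \<subseteq> D.span B"
    if V: "vectorspace K V" and i: "i \<in> Hom (vect K) V D" and A: "A \<subseteq> carrier V"
      "module.span K V A = carrier V" and B: "i ` A \<subseteq> B" "B \<subseteq> carrier D"
    for V :: "('k, 'v) module" and i A B
  proof -
    have V_sub: "carrier V \<subseteq> S" if "submodule K S V" "A \<subseteq> S" for S
      using module.span_is_subset[OF vs_module[OF V] that(2,1)] A(2) by simp
    interpret linear_map K V D i by (rule vect_hom_linear_map) fact+
    have B': "submodule K (D.span B) D" using B(2) by (rule D.span_is_submodule)
    have "submodule K {v \<in> carrier V. i v \<in> D.span B} V"
      using B' by (auto simp: submodule_def vs_module[OF V])
    moreover have "A \<subseteq> {v \<in> carrier V. i v \<in> D.span B}"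
      using A B D.in_own_span[OF B(2)] by auto
    ultimately have "carrier V \<subseteq> {v \<in> carrier V. i v \<in> D.span B}"
      by (rule V_sub)
    then show ?thesis by auto
  qed
  obtain A where A: "finite A" "A \<subseteq> carrier V" "module.span K V A = carrier V"
    using fd(1) vectorspace.fin_dim_def[OF VWD(1)] by auto
  obtain B where B: "finite B" "B \<subseteq> carrier W" "module.span K W B = carrier W"
    using fd(2) vectorspace.fin_dim_def[OF VWD(2)] by auto
  let ?S = "i ` A \<union> j ` B"
  have S: "?S \<subseteq> carrier D" using A(2) B(2) vect_homD(2)[OF i] vect_homD(2)[OF j] by auto
  have "i ` carrier V \<subseteq> D.span ?S" "j ` carrier W \<subseteq> D.span ?S"
    using *[OF VWD(1) i A(2,3) _ S] *[OF VWD(2) j B(2,3) _ S] by auto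
  moreover have "submodule K (D.span ?S) D" using S by (rule D.span_is_submodule)
  ultimately have "carrier D \<subseteq> D.span ?S"
    using D unfolding submodule_def by (metis (no_types, lifting) image_subset_iff subsetI)
  then have "D.span ?S = carrier D" using D.span_is_subset2[OF S] by auto
  moreover have "finite ?S" using A(1) B(1) by simp
  ultimately show ?thesis unfolding D.fin_dim_def using S by (intro exI[of _ ?S] conjI)
qed

section \<open>The abelian category of persistence modules\<close>

locale persistence =
  fixes K :: "('k, 'r) ring_scheme" and P :: "'p rel"
  assumes field: "field K" and partial_order: "Partial_order P"
begin

abbreviation PM :: "(('p, 'k, 'v) pers_module, 'p \<Rightarrow> 'v \<Rightarrow> 'v) add_cat" where
  "PM \<equiv> pers_category K P"

lemma P_refl: "p \<in> Field P \<Longrightarrow> (p, p) \<in> P"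
  using partial_order by (auto simp: partial_order_on_def preorder_on_def refl_on_def)

lemma P_trans: "(p, q) \<in> P \<Longrightarrow> (q, r) \<in> P \<Longrightarrow> (p, r) \<in> P"
  using partial_order by (auto simp: partial_order_on_def preorder_on_def dest: transD)

text \<open>The poset category has an arrow exactly for each pair in \<open>P\<close>, always named
  \<open>()\<close>. The functor laws thus become conditions on \<open>P\<close>, with composites
  unfolded to extensional composition of maps.\<close>

lemma obj_iff:
  "F \<in> Obj PM \<longleftrightarrow> (\<forall>p \<in> Field P. vectorspace K (Fob F p)) \<and>
     (\<forall>p q. (p, q) \<in> P \<longrightarrow> Fmor F p q () \<in> Hom (vect K) (Fob F p) (Fob F q)) \<and>
     (\<forall>p \<in> Field P. Fmor F p p () = (\<lambda>v \<in> carrier (Fob F p). v)) \<and>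
     (\<forall>p q r. (p, q) \<in> P \<longrightarrow> (q, r) \<in> P \<longrightarrow>
        Fmor F p r () = compose (carrier (Fob F p)) (Fmor F q r ()) (Fmor F p q ()))"
  unfolding pers_category_def functor_category_def is_functor_def poset_category_def
  by (auto simp: vect_def FieldI1 FieldI2)

lemma objI:
  assumes "\<And>p. p \<in> Field P \<Longrightarrow> vectorspace K (Fob F p)"
    and "\<And>p q. (p, q) \<in> P \<Longrightarrow> Fmor F p q () \<in> Hom (vect K) (Fob F p) (Fob F q)"
    and "\<And>p v. p \<in> Field P \<Longrightarrow> v \<in> carrier (Fob F p) \<Longrightarrow> Fmor F p p () v = v"
    and "\<And>p q r v. \<lbrakk>(p, q) \<in> P; (q, r) \<in> P; v \<in> carrier (Fob F p)\<rbrakk>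
      \<Longrightarrow> Fmor F p r () v = Fmor F q r () (Fmor F p q () v)"
  shows "F \<in> Obj PM"
  unfolding obj_iff
proof (intro conjI ballI allI impI)
  fix p assume p: "p \<in> Field P"
  show "Fmor F p p () = (\<lambda>v \<in> carrier (Fob F p). v)"
    by (rule extensionalityI[OF vect_homD(1)[OF assms(2)[OF P_refl[OF p]]]]) (use assms(3) p in auto)
next
  fix p q r assume pqr: "(p, q) \<in> P" "(q, r) \<in> P"
  show "Fmor F p r () = compose (carrier (Fob F p)) (Fmor F q r ()) (Fmor F p q ())"
    by (rule extensionalityI[OF vect_homD(1)[OF assms(2)[OF P_trans[OF pqr]]]])
      (use assms(4) pqr in \<open>auto simp: compose_def\<close>)
qed (use assms in auto)

lemma
  assumes "F \<in> Obj PM"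
  shows obj_vs: "p \<in> Field P \<Longrightarrow> vectorspace K (Fob F p)"
    and obj_mor: "(p, q) \<in> P \<Longrightarrow> Fmor F p q () \<in> Hom (vect K) (Fob F p) (Fob F q)"
    and obj_ident: "p \<in> Field P \<Longrightarrow> v \<in> carrier (Fob F p) \<Longrightarrow> Fmor F p p () v = v"
    and obj_comp: "\<lbrakk>(p, q) \<in> P; (q, r) \<in> P; v \<in> carrier (Fob F p)\<rbrakk>
      \<Longrightarrow> Fmor F p r () v = Fmor F q r () (Fmor F p q () v)"
  using assms unfolding obj_iff by (auto simp: compose_def)

lemma obj_mor_closed:
  "\<lbrakk>F \<in> Obj PM; (p, q) \<in> P; v \<in> carrier (Fob F p)\<rbrakk> \<Longrightarrow> Fmor F p q () v \<in> carrier (Fob F q)"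
  using obj_mor vect_homD(2) by metis

lemma hom_iff:
  "\<alpha> \<in> Hom PM F G \<longleftrightarrow> \<alpha> \<in> extensional (Field P) \<and>
     (\<forall>p \<in> Field P. \<alpha> p \<in> Hom (vect K) (Fob F p) (Fob G p)) \<and>
     (\<forall>p q. (p, q) \<in> P \<longrightarrow>
        (\<forall>v \<in> carrier (Fob F p). \<alpha> q (Fmor F p q () v) = Fmor G p q () (\<alpha> p v)))"
  unfolding pers_category_def functor_category_def nat_trans_def poset_category_def PiE_iff
  by (auto simp: compose_def vect_def FieldI1 FieldI2 fun_eq_iff restrict_def split: if_splits)

lemma homI:
  assumes "\<alpha> \<in> extensional (Field P)"
    and "\<And>p. p \<in> Field P \<Longrightarrow> \<alpha> p \<in> Hom (vect K) (Fob F p) (Fob G p)"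
    and "\<And>p q v. \<lbrakk>(p, q) \<in> P; p \<in> Field P; q \<in> Field P; v \<in> carrier (Fob F p)\<rbrakk>
      \<Longrightarrow> \<alpha> q (Fmor F p q () v) = Fmor G p q () (\<alpha> p v)"
  shows "\<alpha> \<in> Hom PM F G"
  using assms unfolding hom_iff by (auto simp: FieldI1 FieldI2)

lemma
  assumes "\<alpha> \<in> Hom PM F G"
  shows hom_ext: "\<alpha> \<in> extensional (Field P)"
    and hom_lin: "p \<in> Field P \<Longrightarrow> \<alpha> p \<in> Hom (vect K) (Fob F p) (Fob G p)"
    and hom_nat: "\<lbrakk>(p, q) \<in> P; v \<in> carrier (Fob F p)\<rbrakk>
      \<Longrightarrow> \<alpha> q (Fmor F p q () v) = Fmor G p q () (\<alpha> p v)"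
  using assms unfolding hom_iff by auto

lemma hom_closed:
  "\<lbrakk>\<alpha> \<in> Hom PM F G; p \<in> Field P; v \<in> carrier (Fob F p)\<rbrakk> \<Longrightarrow> \<alpha> p v \<in> carrier (Fob G p)"
  using hom_lin vect_homD(2) by metis

text \<open>Transformations are extensional in the poset variable and their components in the vector
  variable, so values on carriers decide equality. The categorical identities below are reduced to
  identities of vectors in this way.\<close>

lemma hom_eqI:
  assumes "\<alpha> \<in> Hom PM F G" "\<beta> \<in> Hom PM F G"
    and "\<And>p v. p \<in> Field P \<Longrightarrow> v \<in> carrier (Fob F p) \<Longrightarrow> \<alpha> p v = \<beta> p v"
  shows "\<alpha> = \<beta>"
proof (rule extensionalityI[OF hom_ext[OF assms(1)] hom_ext[OF assms(2)]])
  fix p assume p: "p \<in> Field P"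
  show "\<alpha> p = \<beta> p"
    by (rule extensionalityI[OF vect_homD(1)[OF hom_lin[OF assms(1) p]]
        vect_homD(1)[OF hom_lin[OF assms(2) p]]]) (rule assms(3)[OF p])
qed

section \<open>Composites, identities, sums and zeros of transformations\<close>

lemma comp_apply [simp]:
  "p \<in> Field P \<Longrightarrow> v \<in> carrier (Fob F p) \<Longrightarrow> Comp PM F G H \<beta> \<alpha> p v = \<beta> p (\<alpha> p v)"
  and ident_apply [simp]:
  "p \<in> Field P \<Longrightarrow> v \<in> carrier (Fob F p) \<Longrightarrow> Ident PM F p v = v"
  and add_apply [simp]:
  "p \<in> Field P \<Longrightarrow> v \<in> carrier (Fob F p) \<Longrightarrow> HomAdd PM F G \<alpha> \<beta> p v = \<alpha> p v \<oplus>\<^bsub>Fob G p\<^esub> \<beta> p v"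
  and zero_apply [simp]:
  "p \<in> Field P \<Longrightarrow> v \<in> carrier (Fob F p) \<Longrightarrow> HomZero PM F G p v = \<zero>\<^bsub>Fob G p\<^esub>"
  by (simp_all add: pers_category_def functor_category_def poset_category_def vect_def compose_def)

lemma comp_in_hom:
  assumes "\<alpha> \<in> Hom PM F G" "\<beta> \<in> Hom PM G H" and F: "F \<in> Obj PM"
  shows "Comp PM F G H \<beta> \<alpha> \<in> Hom PM F H"
proof (rule homI)
  show "Comp PM F G H \<beta> \<alpha> \<in> extensional (Field P)"
    by (simp add: pers_category_def functor_category_def poset_category_def)
next
  fix p assume p: "p \<in> Field P"
  have "Comp PM F G H \<beta> \<alpha> p \<in> extensional (carrier (Fob F p))"
    using p by (simp add: pers_category_def functor_category_def poset_category_def vect_def)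
  then show "Comp PM F G H \<beta> \<alpha> p \<in> Hom (vect K) (Fob F p) (Fob H p)"
    using p vect_homD[OF hom_lin[OF assms(1) p]] vect_homD[OF hom_lin[OF assms(2) p]]
      vs_add_closed[OF obj_vs[OF F p]] vs_smult_closed[OF obj_vs[OF F p]]
    by (simp add: vect_hom_iff)
next
  fix p q v assume "(p, q) \<in> P" "p \<in> Field P" "q \<in> Field P" "v \<in> carrier (Fob F p)"
  then show "Comp PM F G H \<beta> \<alpha> q (Fmor F p q () v) = Fmor H p q () (Comp PM F G H \<beta> \<alpha> p v)"
    using assms by (simp add: obj_mor_closed hom_nat hom_closed)
qed

lemma ident_in_hom:
  assumes F: "F \<in> Obj PM"
  shows "Ident PM F \<in> Hom PM F F"
proof (rule homI)
  show "Ident PM F \<in> extensional (Field P)"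
    by (simp add: pers_category_def functor_category_def poset_category_def)
next
  fix p assume p: "p \<in> Field P"
  have "Ident PM F p \<in> extensional (carrier (Fob F p))"
    using p by (simp add: pers_category_def functor_category_def poset_category_def vect_def)
  then show "Ident PM F p \<in> Hom (vect K) (Fob F p) (Fob F p)"
    using p vs_add_closed[OF obj_vs[OF F p]] vs_smult_closed[OF obj_vs[OF F p]]
    by (simp add: vect_hom_iff)
qed (simp add: obj_mor_closed[OF F])

lemma zero_in_hom:
  assumes F: "F \<in> Obj PM" and G: "G \<in> Obj PM"
  shows "HomZero PM F G \<in> Hom PM F G"
proof (rule homI)
  show "HomZero PM F G \<in> extensional (Field P)"
    by (simp add: pers_category_def functor_category_def poset_category_def)
next
  fix p assume p: "p \<in> Field P"
  interpret abelian_group "Fob G p" by (rule vs_abelian[OF obj_vs[OF G p]])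
  have "HomZero PM F G p \<in> extensional (carrier (Fob F p))"
    using p by (simp add: pers_category_def functor_category_def poset_category_def vect_def)
  then show "HomZero PM F G p \<in> Hom (vect K) (Fob F p) (Fob G p)"
    using p vs_add_closed[OF obj_vs[OF F p]] vs_smult_closed[OF obj_vs[OF F p]]
      vs_smult_zero[OF obj_vs[OF G p]]
    by (simp add: vect_hom_iff)
next
  fix p q v assume "(p, q) \<in> P" "p \<in> Field P" "q \<in> Field P" "v \<in> carrier (Fob F p)"
  then show "HomZero PM F G q (Fmor F p q () v) = Fmor G p q () (HomZero PM F G p v)"
    using F G by (simp add: obj_mor_closed vect_hom_zero[OF obj_mor obj_vs obj_vs])
qed

lemma add_in_hom:
  assumes F: "F \<in> Obj PM" and G: "G \<in> Obj PM" and "\<alpha> \<in> Hom PM F G" "\<beta> \<in> Hom PM F G"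
  shows "HomAdd PM F G \<alpha> \<beta> \<in> Hom PM F G"
proof (rule homI)
  show "HomAdd PM F G \<alpha> \<beta> \<in> extensional (Field P)"
    by (simp add: pers_category_def functor_category_def poset_category_def)
next
  fix p assume p: "p \<in> Field P"
  interpret abelian_group "Fob G p" by (rule vs_abelian[OF obj_vs[OF G p]])
  have "HomAdd PM F G \<alpha> \<beta> p \<in> extensional (carrier (Fob F p))"
    using p by (simp add: pers_category_def functor_category_def poset_category_def vect_def)
  then show "HomAdd PM F G \<alpha> \<beta> p \<in> Hom (vect K) (Fob F p) (Fob G p)"
    using p vs_add_closed[OF obj_vs[OF F p]] vs_smult_closed[OF obj_vs[OF F p]]
      vect_homD[OF hom_lin[OF assms(3) p]] vect_homD[OF hom_lin[OF assms(4) p]]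
      module.smult_r_distr[OF vs_module[OF obj_vs[OF G p]]]
    by (simp add: vect_hom_iff a_ac)
next
  fix p q v assume "(p, q) \<in> P" "p \<in> Field P" "q \<in> Field P" "v \<in> carrier (Fob F p)"
  then show "HomAdd PM F G \<alpha> \<beta> q (Fmor F p q () v) = Fmor G p q () (HomAdd PM F G \<alpha> \<beta> p v)"
    using assms by (simp add: obj_mor_closed hom_closed hom_nat vect_homD(3)[OF obj_mor[OF G]])
qed

lemma ex_additive_inverse:
  assumes F: "F \<in> Obj PM" and G: "G \<in> Obj PM" and \<alpha>: "\<alpha> \<in> Hom PM F G"
  shows "\<exists>\<beta> \<in> Hom PM F G. HomAdd PM F G \<beta> \<alpha> = HomZero PM F G"
proof
  define \<beta> where "\<beta> = (\<lambda>p \<in> Field P. \<lambda>v \<in> carrier (Fob F p). \<ominus>\<^bsub>Fob G p\<^esub> \<alpha> p v)"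
  show \<beta>: "\<beta> \<in> Hom PM F G"
  proof (rule homI)
    fix p assume p: "p \<in> Field P"
    interpret abelian_group "Fob G p" by (rule vs_abelian[OF obj_vs[OF G p]])
    show "\<beta> p \<in> Hom (vect K) (Fob F p) (Fob G p)"
      using p vs_add_closed[OF obj_vs[OF F p]] vs_smult_closed[OF obj_vs[OF F p]]
        vect_homD[OF hom_lin[OF \<alpha> p]] module.smult_r_minus[OF vs_module[OF obj_vs[OF G p]]]
      by (simp add: vect_hom_iff \<beta>_def minus_add)
  next
    fix p q v assume *: "(p, q) \<in> P" "p \<in> Field P" "q \<in> Field P" "v \<in> carrier (Fob F p)"
    interpret linear_map K "Fob G p" "Fob G q" "Fmor G p q ()"
      by (rule vect_hom_linear_map) (use * G obj_mor obj_vs in auto)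
    show "\<beta> q (Fmor F p q () v) = Fmor G p q () (\<beta> p v)"
      using * assms hom_closed[OF \<alpha>] by (simp add: \<beta>_def obj_mor_closed hom_nat T_neg)
  qed (simp add: \<beta>_def)
  show "HomAdd PM F G \<beta> \<alpha> = HomZero PM F G"
  proof (rule hom_eqI[OF add_in_hom[OF F G \<beta> \<alpha>] zero_in_hom[OF F G]])
    fix p v assume p: "p \<in> Field P" "v \<in> carrier (Fob F p)"
    interpret abelian_group "Fob G p" by (rule vs_abelian[OF obj_vs[OF G p(1)]])
    show "HomAdd PM F G \<beta> \<alpha> p v = HomZero PM F G p v"
      using p hom_closed[OF \<alpha>] by (simp add: \<beta>_def l_neg)
  qed
qed

lemma preadditive: "preadditive_category (PM :: (('p, 'k, 'v) pers_module, 'p \<Rightarrow> 'v \<Rightarrow> 'v) add_cat)"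
proof (intro preadditive_category.intro category.intro preadditive_category_axioms.intro)
  fix F G :: "('p, 'k, 'v) pers_module" assume F: "F \<in> Obj PM" and G: "G \<in> Obj PM"
  note add = add_in_hom[OF F G] and zero = zero_in_hom[OF F G]
  have assoc: "HomAdd PM F G (HomAdd PM F G \<alpha> \<beta>) \<gamma> = HomAdd PM F G \<alpha> (HomAdd PM F G \<beta> \<gamma>)"
    if *: "\<alpha> \<in> Hom PM F G" "\<beta> \<in> Hom PM F G" "\<gamma> \<in> Hom PM F G" for \<alpha> \<beta> \<gamma>
  proof (rule hom_eqI[OF add[OF add[OF *(1,2)] *(3)] add[OF *(1) add[OF *(2,3)]]])
    fix p v assume p: "p \<in> Field P" "v \<in> carrier (Fob F p)"
    interpret abelian_group "Fob G p" by (rule vs_abelian[OF obj_vs[OF G p(1)]])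
    show "HomAdd PM F G (HomAdd PM F G \<alpha> \<beta>) \<gamma> p v = HomAdd PM F G \<alpha> (HomAdd PM F G \<beta> \<gamma>) p v"
      using p * by (simp add: hom_closed a_assoc)
  qed
  have comm: "HomAdd PM F G \<alpha> \<beta> = HomAdd PM F G \<beta> \<alpha>"
    if *: "\<alpha> \<in> Hom PM F G" "\<beta> \<in> Hom PM F G" for \<alpha> \<beta>
  proof (rule hom_eqI[OF add[OF *(1,2)] add[OF *(2,1)]])
    fix p v assume p: "p \<in> Field P" "v \<in> carrier (Fob F p)"
    interpret abelian_group "Fob G p" by (rule vs_abelian[OF obj_vs[OF G p(1)]])
    show "HomAdd PM F G \<alpha> \<beta> p v = HomAdd PM F G \<beta> \<alpha> p v"
      using p * by (simp add: hom_closed a_comm)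
  qed
  have l_zero: "HomAdd PM F G (HomZero PM F G) \<alpha> = \<alpha>" if *: "\<alpha> \<in> Hom PM F G" for \<alpha>
  proof (rule hom_eqI[OF add[OF zero *] *])
    fix p v assume p: "p \<in> Field P" "v \<in> carrier (Fob F p)"
    interpret abelian_group "Fob G p" by (rule vs_abelian[OF obj_vs[OF G p(1)]])
    show "HomAdd PM F G (HomZero PM F G) \<alpha> p v = \<alpha> p v"
      using p * by (simp add: hom_closed)
  qed
  show "comm_group (hom_group PM F G)"
    by (rule comm_groupI)
      (auto simp: hom_group_def add zero assoc l_zero ex_additive_inverse[OF F G] intro: comm)
next
  fix F G :: "('p, 'k, 'v) pers_module" and \<alpha> assume "F \<in> Obj PM" "G \<in> Obj PM" "\<alpha> \<in> Hom PM F G"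
  note * = this
  show "Comp PM F G G (Ident PM G) \<alpha> = \<alpha>"
    by (rule hom_eqI[of _ F G]) (use * in \<open>auto simp: hom_closed intro!: comp_in_hom ident_in_hom\<close>)
  show "Comp PM F F G \<alpha> (Ident PM F) = \<alpha>"
    by (rule hom_eqI[of _ F G]) (use * in \<open>auto simp: hom_closed intro!: comp_in_hom ident_in_hom\<close>)
next
  fix F G H L :: "('p, 'k, 'v) pers_module" and \<alpha> \<beta> \<gamma>
  assume *: "F \<in> Obj PM" "G \<in> Obj PM" "H \<in> Obj PM" "L \<in> Obj PM"
    "\<alpha> \<in> Hom PM F G" "\<beta> \<in> Hom PM G H" "\<gamma> \<in> Hom PM H L"
  show "Comp PM F H L \<gamma> (Comp PM F G H \<beta> \<alpha>) = Comp PM F G L (Comp PM G H L \<gamma> \<beta>) \<alpha>"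
    by (rule hom_eqI[of _ F L]) (use * in \<open>auto simp: hom_closed intro!: comp_in_hom\<close>)
next
  fix F G H :: "('p, 'k, 'v) pers_module" and \<alpha> \<beta> \<gamma> assume *: "F \<in> Obj PM" "G \<in> Obj PM" "H \<in> Obj PM"
    "\<alpha> \<in> Hom PM F G" "\<beta> \<in> Hom PM G H" "\<gamma> \<in> Hom PM G H"
  show "Comp PM F G H (HomAdd PM G H \<beta> \<gamma>) \<alpha> =
      HomAdd PM F H (Comp PM F G H \<beta> \<alpha>) (Comp PM F G H \<gamma> \<alpha>)"
    by (rule hom_eqI[of _ F H]) (use * in \<open>auto simp: hom_closed intro!: comp_in_hom add_in_hom\<close>)
next
  fix F G H :: "('p, 'k, 'v) pers_module" and \<alpha> \<beta> \<gamma> assume *: "F \<in> Obj PM" "G \<in> Obj PM" "H \<in> Obj PM"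
    "\<alpha> \<in> Hom PM F G" "\<beta> \<in> Hom PM F G" "\<gamma> \<in> Hom PM G H"
  show "Comp PM F G H \<gamma> (HomAdd PM F G \<alpha> \<beta>) =
      HomAdd PM F H (Comp PM F G H \<gamma> \<alpha>) (Comp PM F G H \<gamma> \<beta>)"
    by (rule hom_eqI[of _ F H])
      (use * in \<open>auto simp: hom_closed vect_homD(3)[OF hom_lin[OF *(6)]] intro!: comp_in_hom add_in_hom\<close>)
qed (rule ident_in_hom comp_in_hom; assumption)+

subsection \<open>Kernels and cokernels\<close>

text \<open>A property of an arbitrary pair \<open>(N, \<kappa>)\<close> instead of one model,
  because it is applied to three kinds of pairs: submodules of \<open>F\<close>, pullbacks of
  kernels over another poset, and monomorphisms seen as kernels of their cokernels.\<close>

definition pointwise_kernel ::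
  "('p, 'k, 'v) pers_module \<Rightarrow> ('p, 'k, 'v) pers_module \<Rightarrow> ('p \<Rightarrow> 'v \<Rightarrow> 'v) \<Rightarrow>
   ('p, 'k, 'v) pers_module \<Rightarrow> ('p \<Rightarrow> 'v \<Rightarrow> 'v) \<Rightarrow> bool" where
  "pointwise_kernel F G \<alpha> N \<kappa> \<longleftrightarrow> N \<in> Obj PM \<and> \<kappa> \<in> Hom PM N F \<and>
     (\<forall>p \<in> Field P. inj_on (\<kappa> p) (carrier (Fob N p)) \<and>
        \<kappa> p ` carrier (Fob N p) = {v \<in> carrier (Fob F p). \<alpha> p v = \<zero>\<^bsub>Fob G p\<^esub>})"

definition pointwise_cokernel ::
  "('p, 'k, 'v) pers_module \<Rightarrow> ('p, 'k, 'v) pers_module \<Rightarrow> ('p \<Rightarrow> 'v \<Rightarrow> 'v) \<Rightarrow>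
   ('p, 'k, 'v) pers_module \<Rightarrow> ('p \<Rightarrow> 'v \<Rightarrow> 'v) \<Rightarrow> bool" where
  "pointwise_cokernel F G \<alpha> Q \<pi> \<longleftrightarrow> Q \<in> Obj PM \<and> \<pi> \<in> Hom PM G Q \<and>
     (\<forall>p \<in> Field P. \<pi> p ` carrier (Fob G p) = carrier (Fob Q p) \<and>
        {v \<in> carrier (Fob G p). \<pi> p v = \<zero>\<^bsub>Fob Q p\<^esub>} = \<alpha> p ` carrier (Fob F p))"

lemma pointwise_kernel_is_kernel:
  assumes F: "F \<in> Obj PM" and G: "G \<in> Obj PM" and \<alpha>: "\<alpha> \<in> Hom PM F G"
    and N\<kappa>: "pointwise_kernel F G \<alpha> N \<kappa>"
  shows "is_kernel PM F G \<alpha> N \<kappa>"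
proof -
  have N: "N \<in> Obj PM" and \<kappa>: "\<kappa> \<in> Hom PM N F"
    and inj: "p \<in> Field P \<Longrightarrow> inj_on (\<kappa> p) (carrier (Fob N p))"
    and im: "p \<in> Field P \<Longrightarrow> \<kappa> p ` carrier (Fob N p) = {v \<in> carrier (Fob F p). \<alpha> p v = \<zero>\<^bsub>Fob G p\<^esub>}" for p
    using N\<kappa> by (auto simp: pointwise_kernel_def)
  have "Comp PM N F G \<alpha> \<kappa> = HomZero PM N G"
  proof (rule hom_eqI[OF comp_in_hom[OF \<kappa> \<alpha> N] zero_in_hom[OF N G]])
    fix p v assume p: "p \<in> Field P" "v \<in> carrier (Fob N p)"
    have "\<kappa> p v \<in> \<kappa> p ` carrier (Fob N p)" using p by simp
    then show "Comp PM N F G \<alpha> \<kappa> p v = HomZero PM N G p v" using p im by simp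
  qed
  moreover have "\<exists>!u. u \<in> Hom PM H N \<and> Comp PM H N F \<kappa> u = h"
    if H: "H \<in> Obj PM" and h: "h \<in> Hom PM H F" and 0: "Comp PM H F G \<alpha> h = HomZero PM H G" for H h
  proof
    \<comment> \<open>\<open>\<kappa> p\<close> is injective, so the only possible lift of
      \<open>h\<close> inverts it on its image; injectivity then makes \<open>u\<close> linear,
      natural and unique.\<close>
    define u where "u = (\<lambda>p \<in> Field P. \<lambda>v \<in> carrier (Fob H p). inv_into (carrier (Fob N p)) (\<kappa> p) (h p v))"
    \<comment> \<open>As \<open>h\<close> followed by \<open>\<alpha>\<close> vanishes,
      \<open>h\<close> takes its values in the kernel of \<open>\<alpha>\<close>, which is the image
      of \<open>\<kappa>\<close>.\<close>
    have im_h: "h p v \<in> \<kappa> p ` carrier (Fob N p)" if p: "p \<in> Field P" "v \<in> carrier (Fob H p)" for p v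
      using fun_cong[OF fun_cong[OF 0, of p], of v] p hom_closed[OF h] im[OF p(1)] by simp
    have u_closed: "u p v \<in> carrier (Fob N p)" and \<kappa>u: "\<kappa> p (u p v) = h p v"
      if "p \<in> Field P" "v \<in> carrier (Fob H p)" for p v
      using im_h[OF that] that by (simp_all add: u_def inv_into_into f_inv_into_f)
    have u_eqI: "u p v = w"
      if "p \<in> Field P" "v \<in> carrier (Fob H p)" "w \<in> carrier (Fob N p)" "\<kappa> p w = h p v" for p v w
      using inj_onD[OF inj] u_closed \<kappa>u that by metis
    have u: "u \<in> Hom PM H N"
    proof (rule homI)
      fix p assume p: "p \<in> Field P"
      note [simp] = u_closed[OF p] \<kappa>u[OF p] p
        vs_add_closed[OF obj_vs[OF H p]] vs_smult_closed[OF obj_vs[OF H p]]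
        vs_add_closed[OF obj_vs[OF N p]] vs_smult_closed[OF obj_vs[OF N p]]
        vect_homD(3,4)[OF hom_lin[OF h p]] vect_homD(3,4)[OF hom_lin[OF \<kappa> p]]
      have "u p \<in> extensional (carrier (Fob H p))" by (simp add: u_def)
      then show "u p \<in> Hom (vect K) (Fob H p) (Fob N p)"
        by (auto simp: vect_hom_iff intro!: u_eqI)
    next
      fix p q v assume *: "(p, q) \<in> P" "p \<in> Field P" "q \<in> Field P" "v \<in> carrier (Fob H p)"
      then show "u q (Fmor H p q () v) = Fmor N p q () (u p v)"
        by (intro u_eqI)
          (simp_all add: obj_mor_closed H N u_closed \<kappa>u hom_nat[OF \<kappa>] hom_nat[OF h])
    qed (simp add: u_def)
    moreover have "Comp PM H N F \<kappa> u = h"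
      by (rule hom_eqI[OF comp_in_hom[OF u \<kappa> H] h]) (simp add: \<kappa>u)
    ultimately show "u \<in> Hom PM H N \<and> Comp PM H N F \<kappa> u = h" ..
    fix w assume w: "w \<in> Hom PM H N \<and> Comp PM H N F \<kappa> w = h"
    have "\<kappa> p (w p v) = h p v" if "p \<in> Field P" "v \<in> carrier (Fob H p)" for p v
      using w that by (metis comp_apply)
    then show "w = u"
      using w u_eqI[symmetric] hom_closed[of w H N] by (intro hom_eqI[OF _ u]) simp_all
  qed
  ultimately show ?thesis
    unfolding is_kernel_def using N \<kappa> by blast
qed

lemma pointwise_cokernel_is_cokernel:
  assumes F: "F \<in> Obj PM" and G: "G \<in> Obj PM" and \<alpha>: "\<alpha> \<in> Hom PM F G"
    and Q\<pi>: "pointwise_cokernel F G \<alpha> Q \<pi>"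
  shows "is_cokernel PM F G \<alpha> Q \<pi>"
proof -
  have Q: "Q \<in> Obj PM" and \<pi>: "\<pi> \<in> Hom PM G Q"
    and surj: "p \<in> Field P \<Longrightarrow> \<pi> p ` carrier (Fob G p) = carrier (Fob Q p)"
    and ker: "p \<in> Field P \<Longrightarrow> {v \<in> carrier (Fob G p). \<pi> p v = \<zero>\<^bsub>Fob Q p\<^esub>} = \<alpha> p ` carrier (Fob F p)" for p
    using Q\<pi> by (auto simp: pointwise_cokernel_def)
  have "Comp PM F G Q \<pi> \<alpha> = HomZero PM F Q"
  proof (rule hom_eqI[OF comp_in_hom[OF \<alpha> \<pi> F] zero_in_hom[OF F Q]])
    fix p v assume p: "p \<in> Field P" "v \<in> carrier (Fob F p)"
    have "\<alpha> p v \<in> \<alpha> p ` carrier (Fob F p)" using p by simp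
    then show "Comp PM F G Q \<pi> \<alpha> p v = HomZero PM F Q p v" unfolding ker[OF p(1), symmetric] using p by simp
  qed
  moreover have "\<exists>!u. u \<in> Hom PM Q H \<and> Comp PM G Q H u \<pi> = h"
    if H: "H \<in> Obj PM" and h: "h \<in> Hom PM G H" and 0: "Comp PM F G H h \<alpha> = HomZero PM F H" for H h
  proof
    \<comment> \<open>\<open>u\<close> evaluates \<open>h\<close> at any preimage under
      \<open>\<pi>\<close>; the next fact shows that the choice of the preimage does not
      matter.\<close>
    define u where "u = (\<lambda>p \<in> Field P. \<lambda>s \<in> carrier (Fob Q p). h p (inv_into (carrier (Fob G p)) (\<pi> p) s))"
    \<comment> \<open>Two preimages differ by an element of the kernel of \<open>\<pi>\<close>, that
      is, of the range of \<open>\<alpha>\<close>, and \<open>h\<close> vanishes there.\<close>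
    have h_cong: "h p v = h p w"
      if p: "p \<in> Field P" and vw: "v \<in> carrier (Fob G p)" "w \<in> carrier (Fob G p)"
        and eq: "\<pi> p v = \<pi> p w" for p v w
    proof -
      interpret G: abelian_group "Fob G p" by (rule vs_abelian[OF obj_vs[OF G p]])
      interpret Q: abelian_group "Fob Q p" by (rule vs_abelian[OF obj_vs[OF Q p]])
      interpret H: abelian_group "Fob H p" by (rule vs_abelian[OF obj_vs[OF H p]])
      have "\<pi> p (v \<ominus>\<^bsub>Fob G p\<^esub> w) = \<zero>\<^bsub>Fob Q p\<^esub>"
        using p vw eq hom_closed[OF \<pi> p]
        by (simp add: vect_hom_minus[OF hom_lin[OF \<pi> p] obj_vs[OF G p] obj_vs[OF Q p]])
      then have "v \<ominus>\<^bsub>Fob G p\<^esub> w \<in> \<alpha> p ` carrier (Fob F p)"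
        using ker[OF p] vw by auto
      then obtain x where x: "x \<in> carrier (Fob F p)" "v \<ominus>\<^bsub>Fob G p\<^esub> w = \<alpha> p x" by blast
      have "h p (\<alpha> p x) = \<zero>\<^bsub>Fob H p\<^esub>"
        using fun_cong[OF fun_cong[OF 0, of p], of x] p x by simp
      then have "h p v \<ominus>\<^bsub>Fob H p\<^esub> h p w = \<zero>\<^bsub>Fob H p\<^esub>"
        using vect_hom_minus[OF hom_lin[OF h p] obj_vs[OF G p] obj_vs[OF H p] vw] x by simp
      then show ?thesis using hom_closed[OF h p] vw by simp
    qed
    have u\<pi>: "u p (\<pi> p v) = h p v" if p: "p \<in> Field P" "v \<in> carrier (Fob G p)" for p v
    proof -
      let ?w = "inv_into (carrier (Fob G p)) (\<pi> p) (\<pi> p v)"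
      have "?w \<in> carrier (Fob G p)" "\<pi> p ?w = \<pi> p v"
        using p by (simp_all add: f_inv_into_f inv_into_into)
      then have "h p ?w = h p v" using p by (intro h_cong)
      then show ?thesis using p hom_closed[OF \<pi> p] by (simp add: u_def)
    qed
    have Q_cases: "\<exists>v \<in> carrier (Fob G p). s = \<pi> p v" if "p \<in> Field P" "s \<in> carrier (Fob Q p)" for p s
      using surj[OF that(1)] that(2) by blast
    have u: "u \<in> Hom PM Q H"
    proof (rule homI)
      fix p assume p: "p \<in> Field P"
      note simps = u\<pi>[OF p] p hom_closed[OF h p]
        vs_add_closed[OF obj_vs[OF G p]] vs_smult_closed[OF obj_vs[OF G p]]
        vect_homD(3,4)[OF hom_lin[OF h p]] vect_homD(3,4)[OF hom_lin[OF \<pi> p], symmetric]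
      have "u p \<in> extensional (carrier (Fob Q p))" using p by (simp add: u_def)
      then show "u p \<in> Hom (vect K) (Fob Q p) (Fob H p)"
        unfolding vect_hom_iff surj[OF p, symmetric] by (simp add: simps)
    next
      fix p q s assume *: "(p, q) \<in> P" "p \<in> Field P" "q \<in> Field P" "s \<in> carrier (Fob Q p)"
      then obtain v where v: "v \<in> carrier (Fob G p)" "s = \<pi> p v" using Q_cases by blast
      have "u q (Fmor Q p q () (\<pi> p v)) = u q (\<pi> q (Fmor G p q () v))"
        using * v by (simp add: hom_nat[OF \<pi>])
      also have "\<dots> = Fmor H p q () (u p (\<pi> p v))"
        using * v by (simp add: u\<pi> obj_mor_closed[OF G] hom_nat[OF h])
      finally show "u q (Fmor Q p q () s) = Fmor H p q () (u p s)" using v by simp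
    qed (simp add: u_def)
    moreover have "Comp PM G Q H u \<pi> = h"
      by (rule hom_eqI[OF comp_in_hom[OF \<pi> u G] h]) (simp add: u\<pi>)
    ultimately show "u \<in> Hom PM Q H \<and> Comp PM G Q H u \<pi> = h" ..
    fix w assume w: "w \<in> Hom PM Q H \<and> Comp PM G Q H w \<pi> = h"
    have "w p (\<pi> p v) = h p v" if "p \<in> Field P" "v \<in> carrier (Fob G p)" for p v
      using w that by (metis comp_apply)
    then have "w p s = u p s" if "p \<in> Field P" "s \<in> carrier (Fob Q p)" for p s
      using Q_cases[OF that] u\<pi>[OF that(1)] that(1) by fastforce
    then show "w = u"
      using w by (intro hom_eqI[OF _ u]) simp_all
  qed
  ultimately show ?thesis
    unfolding is_cokernel_def using Q \<pi> by blast
qed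

definition kernel_module ::
  "('p, 'k, 'v) pers_module \<Rightarrow> ('p, 'k, 'v) pers_module \<Rightarrow> ('p \<Rightarrow> 'v \<Rightarrow> 'v) \<Rightarrow> ('p, 'k, 'v) pers_module" where
  "kernel_module F G \<alpha> =
     \<lparr>Fob = (\<lambda>p. (Fob F p)\<lparr>carrier := {v \<in> carrier (Fob F p). \<alpha> p v = \<zero>\<^bsub>Fob G p\<^esub>}\<rparr>),
      Fmor = (\<lambda>p q _. \<lambda>v \<in> {v \<in> carrier (Fob F p). \<alpha> p v = \<zero>\<^bsub>Fob G p\<^esub>}. Fmor F p q () v)\<rparr>"

lemma kernel_subspace:
  assumes F: "F \<in> Obj PM" and G: "G \<in> Obj PM" and \<alpha>: "\<alpha> \<in> Hom PM F G" and p: "p \<in> Field P"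
  shows "subspace K {v \<in> carrier (Fob F p). \<alpha> p v = \<zero>\<^bsub>Fob G p\<^esub>} (Fob F p)"
proof -
  interpret linear_map K "Fob F p" "Fob G p" "\<alpha> p"
    by (rule vect_hom_linear_map) (use assms hom_lin obj_vs in auto)
  show ?thesis using kerT_is_subspace by (simp add: ker_def)
qed

text \<open>The clause on \<open>pfd_modules\<close> serves the essential image: it consists of
  pullbacks of pointwise finite dimensional modules, so the kernel formed over the target must be
  one.\<close>

lemma ex_pointwise_kernel:
  assumes F: "F \<in> Obj PM" and G: "G \<in> Obj PM" and \<alpha>: "\<alpha> \<in> Hom PM F G"
  shows "\<exists>N \<kappa>. pointwise_kernel F G \<alpha> N \<kappa> \<and> (F \<in> pfd_modules K P \<longrightarrow> N \<in> pfd_modules K P)"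
proof -
  define N where "N = kernel_module F G \<alpha>"
  define \<kappa> where "\<kappa> = (\<lambda>p \<in> Field P. \<lambda>v \<in> carrier (Fob N p). v)"
  have N_vs: "vectorspace K (Fob N p)" if "p \<in> Field P" for p
    using vectorspace.subspace_is_vs[OF obj_vs kernel_subspace] that assms
    by (simp add: N_def kernel_module_def)
  have \<alpha>0: "\<alpha> q (Fmor F p q () v) = \<zero>\<^bsub>Fob G q\<^esub>"
    if "(p, q) \<in> P" "v \<in> carrier (Fob F p)" "\<alpha> p v = \<zero>\<^bsub>Fob G p\<^esub>" for p q v
    using that vect_hom_zero[OF obj_mor[OF G] obj_vs[OF G] obj_vs[OF G]]
    by (simp add: hom_nat[OF \<alpha>] FieldI1 FieldI2)
  have N: "N \<in> Obj PM"
  proof (rule objI)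
    fix p q assume pq: "(p, q) \<in> P"
    then have p: "p \<in> Field P" and q: "q \<in> Field P" by (auto simp: FieldI1 FieldI2)
    show "Fmor N p q () \<in> Hom (vect K) (Fob N p) (Fob N q)"
      using vect_homD[OF obj_mor[OF F pq]] \<alpha>0[OF pq]
        vs_add_closed[OF N_vs[OF p]] vs_smult_closed[OF N_vs[OF p]]
      by (simp add: vect_hom_iff N_def kernel_module_def)
  qed (auto simp: N_vs, auto simp: N_def kernel_module_def obj_ident[OF F] obj_comp[OF F] \<alpha>0
      obj_mor_closed[OF F])
  have "\<kappa> \<in> Hom PM N F"
  proof (rule homI)
    fix p assume p: "p \<in> Field P"
    show "\<kappa> p \<in> Hom (vect K) (Fob N p) (Fob F p)"
      using vs_add_closed[OF N_vs[OF p]] vs_smult_closed[OF N_vs[OF p]] p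
      by (simp add: vect_hom_iff \<kappa>_def N_def kernel_module_def)
  next
    fix p q v assume "(p, q) \<in> P" "p \<in> Field P" "q \<in> Field P" "v \<in> carrier (Fob N p)"
    then show "\<kappa> q (Fmor N p q () v) = Fmor F p q () (\<kappa> p v)"
      by (simp add: \<kappa>_def N_def kernel_module_def \<alpha>0 obj_mor_closed[OF F])
  qed (simp add: \<kappa>_def)
  then have "pointwise_kernel F G \<alpha> N \<kappa>"
    unfolding pointwise_kernel_def using N
    by (auto simp: \<kappa>_def N_def kernel_module_def inj_on_def)
  moreover have "N \<in> pfd_modules K P" if "F \<in> pfd_modules K P"
    using that N subspace_fin_dim[OF obj_vs[OF F] _ kernel_subspace[OF F G \<alpha>]]
    by (auto simp: pfd_modules_def N_def kernel_module_def)
  ultimately show ?thesis by blast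
qed

end

text \<open>The value type may change from \<open>'v\<close> to \<open>'w\<close>. With equal types
  and coset representatives for \<open>r\<close> this is a quotient module; with
  \<open>'v \<times> 'v\<close> as source and an injection for \<open>r\<close> it brings a direct
  sum back into \<open>'v\<close>.\<close>

definition image_module ::
  "('p, 'k, 'v) pers_module \<Rightarrow> ('p \<Rightarrow> 'v \<Rightarrow> 'w) \<Rightarrow> ('p, 'k, 'w) pers_module" where
  "image_module F r = \<lparr>Fob = (\<lambda>p. image_space (Fob F p) (r p)),
     Fmor = (\<lambda>p q _. \<lambda>s \<in> r p ` carrier (Fob F p).
       r q (Fmor F p q () (inv_into (carrier (Fob F p)) (r p) s)))\<rparr>"

lemma image_module_Fob [simp]: "Fob (image_module F r) p = image_space (Fob F p) (r p)"
  by (simp add: image_module_def)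

context persistence
begin

lemma image_module_Fmor:
  assumes "\<And>u v. \<lbrakk>u \<in> carrier (Fob F p); v \<in> carrier (Fob F p); r p u = r p v\<rbrakk>
      \<Longrightarrow> r q (Fmor F p q () u) = r q (Fmor F p q () v)"
    and v: "v \<in> carrier (Fob F p)"
  shows "Fmor (image_module F r) p q () (r p v) = r q (Fmor F p q () v)"
  using v by (simp add: image_module_def) (rule assms(1), simp_all add: f_inv_into_f inv_into_into)

lemma image_module_obj:
  fixes F :: "('p, 'k, 'v) pers_module" and r :: "'p \<Rightarrow> 'v \<Rightarrow> 'w"
  assumes F: "F \<in> Obj PM"
    and lin: "\<And>p. p \<in> Field P \<Longrightarrow> linear_congruence K (Fob F p) (r p)"
    and mor: "\<And>p q u v. \<lbrakk>(p, q) \<in> P; u \<in> carrier (Fob F p); v \<in> carrier (Fob F p); r p u = r p v\<rbrakk>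
      \<Longrightarrow> r q (Fmor F p q () u) = r q (Fmor F p q () v)"
  shows "image_module F r \<in> Obj PM"
proof (rule objI)
  fix p q assume pq: "(p, q) \<in> P"
  then have p: "p \<in> Field P" and q: "q \<in> Field P" by (auto simp: FieldI1 FieldI2)
  have "Fmor (image_module F r) p q () \<in> extensional (r p ` carrier (Fob F p))"
    by (simp add: image_module_def)
  then show "Fmor (image_module F r) p q () \<in>
      Hom (vect K) (Fob (image_module F r) p) (Fob (image_module F r) q)"
    using image_space_add[OF lin[OF p]] image_space_add[OF lin[OF q]]
      image_space_smult[OF lin[OF p]] image_space_smult[OF lin[OF q]]
      vs_add_closed[OF obj_vs[OF F p]] vs_smult_closed[OF obj_vs[OF F p]]
      vect_homD(2-)[OF obj_mor[OF F pq]]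
    by (simp add: vect_hom_iff image_module_Fmor[where r=r, OF mor[OF pq]])
next
  fix p q s t v assume pq: "(p, q) \<in> P" and qs: "(q, s) \<in> P" and t: "t \<in> carrier (Fob (image_module F r) p)"
  from t obtain v where "v \<in> carrier (Fob F p)" "t = r p v" by auto
  then show "Fmor (image_module F r) p s () t =
      Fmor (image_module F r) q s () (Fmor (image_module F r) p q () t)"
    by (simp add: image_module_Fmor[where r=r, OF mor[OF pq]] image_module_Fmor[where r=r, OF mor[OF qs]]
        image_module_Fmor[where r=r, OF mor[OF P_trans[OF pq qs]]] obj_mor_closed[OF F pq] obj_comp[OF F pq qs])
next
  fix p t assume p: "p \<in> Field P" and t: "t \<in> carrier (Fob (image_module F r) p)"
  from t obtain v where "v \<in> carrier (Fob F p)" "t = r p v" by auto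
  then show "Fmor (image_module F r) p p () t = t"
    using p by (simp add: image_module_Fmor[where r=r, OF mor[OF P_refl[OF p]]] obj_ident[OF F])
qed (simp add: image_space_vectorspace obj_vs[OF F] lin)

text \<open>Representatives are chosen independently at each \<open>p\<close>. No compatibility of
  the choices is required, because the structure maps respect cosets and are transported through
  them.\<close>

lemma ex_pointwise_cokernel:
  fixes F G :: "('p, 'k, 'v) pers_module"
  assumes F: "F \<in> Obj PM" and G: "G \<in> Obj PM" and \<alpha>: "\<alpha> \<in> Hom PM F G"
  shows "\<exists>Q \<pi>. pointwise_cokernel F G \<alpha> Q \<pi> \<and> (G \<in> pfd_modules K P \<longrightarrow> Q \<in> pfd_modules K P)"
proof -
  have "\<forall>p \<in> Field P. \<exists>r :: 'v \<Rightarrow> 'v. \<forall>u \<in> carrier (Fob G p). \<forall>v \<in> carrier (Fob G p).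
      r u = r v \<longleftrightarrow> u \<ominus>\<^bsub>Fob G p\<^esub> v \<in> \<alpha> p ` carrier (Fob F p)"
    using ex_coset_representatives[OF obj_vs[OF F] obj_vs[OF G] hom_lin[OF \<alpha>]] by simp
  then obtain r where r: "\<forall>p \<in> Field P. \<forall>u \<in> carrier (Fob G p). \<forall>v \<in> carrier (Fob G p).
      (r p :: 'v \<Rightarrow> 'v) u = r p v \<longleftrightarrow> u \<ominus>\<^bsub>Fob G p\<^esub> v \<in> \<alpha> p ` carrier (Fob F p)"
    by (rule bchoice[THEN exE])
  have lin: "linear_congruence K (Fob G p) (r p)" if "p \<in> Field P" for p
    by (rule coset_linear_congruence[OF obj_vs[OF F] obj_vs[OF G] hom_lin[OF \<alpha>]]) (use r that in simp_all)
  \<comment> \<open>By naturality of \<open>\<alpha>\<close> a difference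
    \<open>\<alpha> p x\<close> is sent to \<open>\<alpha> q\<close> of the image of
    \<open>x\<close>, so the structure map of \<open>G\<close> sends cosets into cosets.\<close>
  have mor: "r q (Fmor G p q () u) = r q (Fmor G p q () v)"
    if *: "(p, q) \<in> P" "u \<in> carrier (Fob G p)" "v \<in> carrier (Fob G p)" "r p u = r p v" for p q u v
  proof -
    have pq: "p \<in> Field P" "q \<in> Field P" using that by (auto simp: FieldI1 FieldI2)
    then have "u \<ominus>\<^bsub>Fob G p\<^esub> v \<in> \<alpha> p ` carrier (Fob F p)"
      using r * by simp
    then obtain x where x: "x \<in> carrier (Fob F p)" "u \<ominus>\<^bsub>Fob G p\<^esub> v = \<alpha> p x"
      by blast
    then have "Fmor G p q () u \<ominus>\<^bsub>Fob G q\<^esub> Fmor G p q () v = \<alpha> q (Fmor F p q () x)"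
      using vect_hom_minus[OF obj_mor[OF G *(1)] obj_vs[OF G pq(1)] obj_vs[OF G pq(2)] *(2,3)] *(1)
      by (simp add: hom_nat[OF \<alpha>])
    moreover have "Fmor F p q () x \<in> carrier (Fob F q)" by (rule obj_mor_closed[OF F *(1) x(1)])
    ultimately show ?thesis
      using r pq(2) obj_mor_closed[OF G *(1)] *(2,3) by simp
  qed
  define Q where "Q = image_module G r"
  define \<pi> where "\<pi> = (\<lambda>p \<in> Field P. \<lambda>v \<in> carrier (Fob G p). r p v)"
  have Q: "Q \<in> Obj PM" unfolding Q_def by (rule image_module_obj[OF G lin mor])
  have \<pi>: "\<pi> \<in> Hom PM G Q"
  proof (rule homI)
    fix p assume p: "p \<in> Field P"
    show "\<pi> p \<in> Hom (vect K) (Fob G p) (Fob Q p)"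
      using p vs_add_closed[OF obj_vs[OF G p]] vs_smult_closed[OF obj_vs[OF G p]]
        image_space_add[OF lin[OF p]] image_space_smult[OF lin[OF p]]
      by (simp add: vect_hom_iff \<pi>_def Q_def)
  next
    fix p q v assume *: "(p, q) \<in> P" "p \<in> Field P" "q \<in> Field P" "v \<in> carrier (Fob G p)"
    then show "\<pi> q (Fmor G p q () v) = Fmor Q p q () (\<pi> p v)"
      by (simp add: \<pi>_def Q_def image_module_Fmor[where r=r, OF mor] obj_mor_closed[OF G])
  qed (simp add: \<pi>_def)
  have surj: "\<pi> p ` carrier (Fob G p) = carrier (Fob Q p)" if "p \<in> Field P" for p
    using that by (simp add: \<pi>_def Q_def)
  have "{v \<in> carrier (Fob G p). \<pi> p v = \<zero>\<^bsub>Fob Q p\<^esub>} = \<alpha> p ` carrier (Fob F p)" if p: "p \<in> Field P" for p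
  proof -
    interpret G: abelian_group "Fob G p" by (rule vs_abelian[OF obj_vs[OF G p]])
    have "v \<ominus>\<^bsub>Fob G p\<^esub> \<zero>\<^bsub>Fob G p\<^esub> = v" if "v \<in> carrier (Fob G p)" for v
      using that by (simp add: G.minus_eq)
    then show ?thesis
      using p r G.zero_closed hom_closed[OF \<alpha> p] by (auto simp: \<pi>_def Q_def)
  qed
  then have "pointwise_cokernel F G \<alpha> Q \<pi>"
    unfolding pointwise_cokernel_def using Q \<pi> surj by simp
  moreover have "Q \<in> pfd_modules K P" if "G \<in> pfd_modules K P"
  proof -
    have "vectorspace.fin_dim K (Fob Q p)" if p: "p \<in> Field P" for p
      using linear_map.surj_fin_dim[OF vect_hom_linear_map[OF hom_lin[OF \<pi> p] obj_vs[OF G p] obj_vs[OF Q p]]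
          _ surj[OF p]]
        \<open>G \<in> pfd_modules K P\<close> p by (simp add: pfd_modules_def)
    then show ?thesis using Q by (simp add: pfd_modules_def)
  qed
  ultimately show ?thesis by blast
qed

subsection \<open>Zero objects and direct sums\<close>

lemma zero_objectI:
  fixes Z :: "('p, 'k, 'v) pers_module"
  assumes Z: "Z \<in> Obj PM" and 0: "\<And>p. p \<in> Field P \<Longrightarrow> carrier (Fob Z p) = {\<zero>\<^bsub>Fob Z p\<^esub>}"
  shows "zero_object PM Z"
  unfolding zero_object_def
proof (intro conjI ballI)
  fix F :: "('p, 'k, 'v) pers_module" assume F: "F \<in> Obj PM"
  note hom_zero = vect_hom_zero[OF hom_lin obj_vs obj_vs]
  show "\<exists>!f. f \<in> Hom PM Z F"
  proof
    fix f assume f: "f \<in> Hom PM Z F"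
    show "f = HomZero PM Z F"
      by (rule hom_eqI[OF f zero_in_hom[OF Z F]]) (use 0 hom_zero[OF f _ Z _ F] in auto)
  qed (rule zero_in_hom[OF Z F])
  show "\<exists>!f. f \<in> Hom PM F Z"
  proof
    fix f assume f: "f \<in> Hom PM F Z"
    show "f = HomZero PM F Z"
      by (rule hom_eqI[OF f zero_in_hom[OF F Z]]) (use 0 hom_closed[OF f] in auto)
  qed (rule zero_in_hom[OF F Z])
qed (rule Z)

lemma ex_zero_module:
  "\<exists>Z :: ('p, 'k, 'v) pers_module. Z \<in> pfd_modules K P \<and>
     (\<forall>p \<in> Field P. carrier (Fob Z p) = {\<zero>\<^bsub>Fob Z p\<^esub>})"
proof -
  define V :: "('k, 'v) module" where
    "V = \<lparr>carrier = {undefined}, mult = (\<lambda>_ _. undefined), one = undefined, zero = undefined,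
       add = (\<lambda>_ _. undefined), smult = (\<lambda>_ _. undefined)\<rparr>"
  define Z :: "('p, 'k, 'v) pers_module" where
    "Z = \<lparr>Fob = (\<lambda>_. V), Fmor = (\<lambda>_ _ _. \<lambda>v \<in> carrier V. v)\<rparr>"
  have "module K V"
    by (rule module_criteria) (use field in \<open>auto simp: V_def field_def domain_def\<close>)
  then have V: "vectorspace K V" by (simp add: vectorspace_def field)
  interpret V: vectorspace K V by (rule V)
  have "V.span (carrier V) = carrier V"
    using V.span_is_subset2[of "carrier V"] V.in_own_span[of "carrier V"] by auto
  then have "V.fin_dim"
    unfolding V.fin_dim_def by (intro exI[of _ "carrier V"]) (simp add: V_def)
  moreover have "Z \<in> Obj PM"
    by (rule objI) (use V in \<open>auto simp: Z_def vect_hom_iff V_def\<close>)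
  ultimately have "Z \<in> pfd_modules K P" by (simp add: pfd_modules_def Z_def)
  then show ?thesis by (auto simp: Z_def V_def)
qed

lemma biproductI:
  fixes F G S :: "('p, 'k, 'v) pers_module"
  assumes F: "F \<in> Obj PM" and G: "G \<in> Obj PM" and S: "S \<in> Obj PM"
    and i: "i \<in> Hom PM F S" and j: "j \<in> Hom PM G S" and f: "f \<in> Hom PM S F" and g: "g \<in> Hom PM S G"
    and fi: "\<And>p v. p \<in> Field P \<Longrightarrow> v \<in> carrier (Fob F p) \<Longrightarrow> f p (i p v) = v"
    and gj: "\<And>p v. p \<in> Field P \<Longrightarrow> v \<in> carrier (Fob G p) \<Longrightarrow> g p (j p v) = v"
    and gi: "\<And>p v. p \<in> Field P \<Longrightarrow> v \<in> carrier (Fob F p) \<Longrightarrow> g p (i p v) = \<zero>\<^bsub>Fob G p\<^esub>"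
    and fj: "\<And>p v. p \<in> Field P \<Longrightarrow> v \<in> carrier (Fob G p) \<Longrightarrow> f p (j p v) = \<zero>\<^bsub>Fob F p\<^esub>"
    and sum: "\<And>p s. p \<in> Field P \<Longrightarrow> s \<in> carrier (Fob S p) \<Longrightarrow> i p (f p s) \<oplus>\<^bsub>Fob S p\<^esub> j p (g p s) = s"
  shows "is_biproduct PM F G S"
  unfolding is_biproduct_def
proof (intro conjI bexI)
  note homs = comp_in_hom add_in_hom ident_in_hom zero_in_hom F G S i j f g
  show "Comp PM F S F f i = Ident PM F"
    by (rule hom_eqI[of _ F F]) (simp_all add: fi homs)
  show "Comp PM G S G g j = Ident PM G"
    by (rule hom_eqI[of _ G G]) (simp_all add: gj homs)
  show "Comp PM F S G g i = HomZero PM F G"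
    by (rule hom_eqI[of _ F G]) (simp_all add: gi homs)
  show "Comp PM G S F f j = HomZero PM G F"
    by (rule hom_eqI[of _ G F]) (simp_all add: fj homs)
  show "HomAdd PM S S (Comp PM S F S i f) (Comp PM S G S j g) = Ident PM S"
    by (rule hom_eqI[of _ S S]) (simp_all add: sum homs)
qed (fact+)

text \<open>The sum is first formed as \<open>T\<close> with values in
  \<open>'v \<times> 'v\<close>, where the module laws are componentwise, and then copied into
  \<open>'v\<close> along a bijection of the two types.\<close>

lemma ex_direct_sum:
  fixes F G :: "('p, 'k, 'v) pers_module"
  assumes inf: "infinite (UNIV :: 'v set)" and F: "F \<in> Obj PM" and G: "G \<in> Obj PM"
  shows "\<exists>S. is_biproduct PM F G S \<and> (F \<in> pfd_modules K P \<longrightarrow> G \<in> pfd_modules K P \<longrightarrow> S \<in> pfd_modules K P)"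
proof -
  \<comment> \<open>An infinite type is equinumerous with its square.\<close>
  obtain \<iota> :: "'v \<times> 'v \<Rightarrow> 'v" where "bij_betw \<iota> (UNIV \<times> UNIV) UNIV"
    using iffD2[OF card_of_ordIso card_of_Times_same_infinite[OF inf]] by blast
  then have inj: "inj_on \<iota> A" for A
    by (metis UNIV_Times_UNIV bij_betw_imp_inj_on inj_on_subset subset_UNIV)
  have inv: "inv_into A \<iota> (\<iota> x) = x" if "x \<in> A" for A x using inj that by (rule inv_into_f_f)
  define T :: "('p, 'k, 'v \<times> 'v) pers_module" where
    "T = \<lparr>Fob = (\<lambda>p. direct_sum (Fob F p) (Fob G p)),
       Fmor = (\<lambda>p q _. \<lambda>x \<in> carrier (Fob F p) \<times> carrier (Fob G p).
         (Fmor F p q () (fst x), Fmor G p q () (snd x)))\<rparr>"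
  have T: "T \<in> Obj PM"
  proof (rule objI)
    fix p assume "p \<in> Field P"
    then show "vectorspace K (Fob T p)"
      by (simp add: T_def direct_sum_is_vs obj_vs[OF F] obj_vs[OF G])
  next
    fix p q assume pq: "(p, q) \<in> P"
    then have p: "p \<in> Field P" by (rule FieldI1)
    show "Fmor T p q () \<in> Hom (vect K) (Fob T p) (Fob T q)"
      using vect_homD[OF obj_mor[OF F pq]] vect_homD[OF obj_mor[OF G pq]]
        vs_add_closed[OF obj_vs[OF F p]] vs_smult_closed[OF obj_vs[OF F p]]
        vs_add_closed[OF obj_vs[OF G p]] vs_smult_closed[OF obj_vs[OF G p]]
      by (auto simp: vect_hom_iff T_def direct_sum_def)
  qed (auto simp: T_def direct_sum_def obj_ident[OF F] obj_ident[OF G] obj_comp[OF F] obj_comp[OF G]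
      obj_mor_closed[OF F] obj_mor_closed[OF G])
  define S :: "('p, 'k, 'v) pers_module" where "S = image_module T (\<lambda>_. \<iota>)"
  have lin: "linear_congruence K V \<iota>" for V :: "('k, 'v \<times> 'v) module"
    by (rule inj_linear_congruence[OF inj])
  have S: "S \<in> Obj PM"
    unfolding S_def by (rule image_module_obj[OF T lin]) (metis inv UNIV_I)
  have S_mor: "Fmor S p q () (\<iota> (v, w)) = \<iota> (Fmor F p q () v, Fmor G p q () w)"
    if "v \<in> carrier (Fob F p)" "w \<in> carrier (Fob G p)" for p q v w
    using that by (simp add: S_def image_module_def T_def direct_sum_def inv)
  have S_carrier: "carrier (Fob S p) = \<iota> ` (carrier (Fob F p) \<times> carrier (Fob G p))" for p
    by (simp add: S_def T_def direct_sum_def)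
  have S_add: "\<iota> (v, w) \<oplus>\<^bsub>Fob S p\<^esub> \<iota> (v', w') = \<iota> (v \<oplus>\<^bsub>Fob F p\<^esub> v', w \<oplus>\<^bsub>Fob G p\<^esub> w')"
    if "v \<in> carrier (Fob F p)" "w \<in> carrier (Fob G p)" "v' \<in> carrier (Fob F p)" "w' \<in> carrier (Fob G p)"
    for p v w v' w'
    using that image_space_add[OF lin, of "(v, w)" "Fob T p" "(v', w')"]
    by (simp add: S_def T_def direct_sum_def)
  have S_smult: "c \<odot>\<^bsub>Fob S p\<^esub> \<iota> (v, w) = \<iota> (c \<odot>\<^bsub>Fob F p\<^esub> v, c \<odot>\<^bsub>Fob G p\<^esub> w)"
    if "c \<in> carrier K" "v \<in> carrier (Fob F p)" "w \<in> carrier (Fob G p)" for c p v w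
    using that image_space_smult[OF lin, of c "(v, w)" "Fob T p"]
    by (simp add: S_def T_def direct_sum_def)
  define i where "i = (\<lambda>p \<in> Field P. \<lambda>v \<in> carrier (Fob F p). \<iota> (v, \<zero>\<^bsub>Fob G p\<^esub>))"
  define j where "j = (\<lambda>p \<in> Field P. \<lambda>w \<in> carrier (Fob G p). \<iota> (\<zero>\<^bsub>Fob F p\<^esub>, w))"
  define f where "f = (\<lambda>p \<in> Field P. \<lambda>s \<in> carrier (Fob S p). fst (inv_into UNIV \<iota> s))"
  define g where "g = (\<lambda>p \<in> Field P. \<lambda>s \<in> carrier (Fob S p). snd (inv_into UNIV \<iota> s))"
  note F0 = vs_zero_closed[OF obj_vs[OF F]] and G0 = vs_zero_closed[OF obj_vs[OF G]]
  note Fmor0 = vect_hom_zero[OF obj_mor[OF F] obj_vs[OF F] obj_vs[OF F]]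
    and Gmor0 = vect_hom_zero[OF obj_mor[OF G] obj_vs[OF G] obj_vs[OF G]]
  have S_case: "\<exists>v \<in> carrier (Fob F p). \<exists>w \<in> carrier (Fob G p). s = \<iota> (v, w)" if "s \<in> carrier (Fob S p)" for s p
    using that unfolding S_carrier by auto
  have i: "i \<in> Hom PM F S"
  proof (rule homI)
    fix p assume p: "p \<in> Field P"
    interpret G: abelian_group "Fob G p" by (rule vs_abelian[OF obj_vs[OF G p]])
    show "i p \<in> Hom (vect K) (Fob F p) (Fob S p)"
      using p vs_add_closed[OF obj_vs[OF F p]] vs_smult_closed[OF obj_vs[OF F p]]
        vs_smult_zero[OF obj_vs[OF G p]]
      by (simp add: vect_hom_iff i_def S_add S_smult S_carrier)
  next
    fix p q v assume "(p, q) \<in> P" "p \<in> Field P" "q \<in> Field P" "v \<in> carrier (Fob F p)"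
    then show "i q (Fmor F p q () v) = Fmor S p q () (i p v)"
      using F0 G0 Gmor0 by (simp add: i_def S_mor obj_mor_closed[OF F])
  qed (simp add: i_def)
  have j: "j \<in> Hom PM G S"
  proof (rule homI)
    fix p assume p: "p \<in> Field P"
    interpret F: abelian_group "Fob F p" by (rule vs_abelian[OF obj_vs[OF F p]])
    show "j p \<in> Hom (vect K) (Fob G p) (Fob S p)"
      using p vs_add_closed[OF obj_vs[OF G p]] vs_smult_closed[OF obj_vs[OF G p]]
        vs_smult_zero[OF obj_vs[OF F p]]
      by (simp add: vect_hom_iff j_def S_add S_smult S_carrier)
  next
    fix p q v assume "(p, q) \<in> P" "p \<in> Field P" "q \<in> Field P" "v \<in> carrier (Fob G p)"
    then show "j q (Fmor G p q () v) = Fmor S p q () (j p v)"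
      using F0 G0 Fmor0 by (simp add: j_def S_mor obj_mor_closed[OF G])
  qed (simp add: j_def)
  have f_apply: "f p (\<iota> (v, w)) = v" and g_apply: "g p (\<iota> (v, w)) = w"
    if "p \<in> Field P" "v \<in> carrier (Fob F p)" "w \<in> carrier (Fob G p)" for p v w
    using that by (simp_all add: f_def g_def S_carrier inv)
  have f: "f \<in> Hom PM S F"
  proof (rule homI)
    fix p assume p: "p \<in> Field P"
    have "f p \<in> extensional (carrier (Fob S p))" using p by (simp add: f_def)
    then show "f p \<in> Hom (vect K) (Fob S p) (Fob F p)"
      using p vs_add_closed[OF obj_vs[OF G p]] vs_smult_closed[OF obj_vs[OF G p]]
        vs_add_closed[OF obj_vs[OF F p]] vs_smult_closed[OF obj_vs[OF F p]]
      by (auto simp: vect_hom_iff S_carrier f_apply S_add S_smult)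
  next
    fix p q s assume *: "(p, q) \<in> P" "p \<in> Field P" "q \<in> Field P" "s \<in> carrier (Fob S p)"
    then show "f q (Fmor S p q () s) = Fmor F p q () (f p s)"
      by (auto simp: S_carrier S_mor f_apply obj_mor_closed[OF F] obj_mor_closed[OF G])
  qed (simp add: f_def)
  have g: "g \<in> Hom PM S G"
  proof (rule homI)
    fix p assume p: "p \<in> Field P"
    have "g p \<in> extensional (carrier (Fob S p))" using p by (simp add: g_def)
    then show "g p \<in> Hom (vect K) (Fob S p) (Fob G p)"
      using p vs_add_closed[OF obj_vs[OF G p]] vs_smult_closed[OF obj_vs[OF G p]]
        vs_add_closed[OF obj_vs[OF F p]] vs_smult_closed[OF obj_vs[OF F p]]
      by (auto simp: vect_hom_iff S_carrier g_apply S_add S_smult)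
  next
    fix p q s assume *: "(p, q) \<in> P" "p \<in> Field P" "q \<in> Field P" "s \<in> carrier (Fob S p)"
    then show "g q (Fmor S p q () s) = Fmor G p q () (g p s)"
      by (auto simp: S_carrier S_mor g_apply obj_mor_closed[OF F] obj_mor_closed[OF G])
  qed (simp add: g_def)
  have sum: "i p v \<oplus>\<^bsub>Fob S p\<^esub> j p w = \<iota> (v, w)"
    if "p \<in> Field P" "v \<in> carrier (Fob F p)" "w \<in> carrier (Fob G p)" for p v w
  proof -
    interpret F: abelian_group "Fob F p" by (rule vs_abelian[OF obj_vs[OF F that(1)]])
    interpret G: abelian_group "Fob G p" by (rule vs_abelian[OF obj_vs[OF G that(1)]])
    show ?thesis using that by (simp add: i_def j_def S_add)
  qed
  have "is_biproduct PM F G S"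
  proof (rule biproductI[OF F G S i j f g])
    fix p s assume *: "p \<in> Field P" "s \<in> carrier (Fob S p)"
    then show "i p (f p s) \<oplus>\<^bsub>Fob S p\<^esub> j p (g p s) = s"
      by (auto simp: S_carrier f_apply g_apply sum)
  qed (use F0 G0 in \<open>simp_all add: i_def j_def f_apply g_apply\<close>)
  moreover have "S \<in> pfd_modules K P" if pfd: "F \<in> pfd_modules K P" "G \<in> pfd_modules K P"
  proof -
    have "vectorspace.fin_dim K (Fob S p)" if p: "p \<in> Field P" for p
    proof (rule sum_fin_dim[OF obj_vs[OF F p] obj_vs[OF G p] obj_vs[OF S p] _ _
          hom_lin[OF i p] hom_lin[OF j p]])
      fix s assume "s \<in> carrier (Fob S p)"
      then show "\<exists>v \<in> carrier (Fob F p). \<exists>w \<in> carrier (Fob G p). s = i p v \<oplus>\<^bsub>Fob S p\<^esub> j p w"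
        using S_case sum[OF p] by metis
    qed (use pfd p in \<open>simp_all add: pfd_modules_def\<close>)
    then show ?thesis using S by (simp add: pfd_modules_def)
  qed
  ultimately show ?thesis by blast
qed

subsection \<open>Monomorphisms and epimorphisms\<close>

text \<open>A kernel \<open>\<kappa>\<close> of \<open>\<alpha>\<close> and the zero map have the
  same composite with \<open>\<alpha>\<close>, so \<open>\<kappa>\<close> is zero. Its image is the
  pointwise kernel of \<open>\<alpha>\<close>, which is therefore trivial.\<close>

lemma monic_injective:
  assumes F: "F \<in> Obj PM" and G: "G \<in> Obj PM" and m: "is_monic PM F G \<alpha>" and p: "p \<in> Field P"
  shows "inj_on (\<alpha> p) (carrier (Fob F p))"
proof -
  have \<alpha>: "\<alpha> \<in> Hom PM F G" using m by (simp add: is_monic_def)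
  obtain N \<kappa> where N\<kappa>: "pointwise_kernel F G \<alpha> N \<kappa>" using ex_pointwise_kernel[OF F G \<alpha>] by blast
  then have N: "N \<in> Obj PM" and \<kappa>: "\<kappa> \<in> Hom PM N F"
    and im: "\<kappa> p ` carrier (Fob N p) = {v \<in> carrier (Fob F p). \<alpha> p v = \<zero>\<^bsub>Fob G p\<^esub>}"
    using p by (auto simp: pointwise_kernel_def)
  have "Comp PM N F G \<alpha> \<kappa> = HomZero PM N G"
    using pointwise_kernel_is_kernel[OF F G \<alpha> N\<kappa>] by (simp add: is_kernel_def)
  also have "\<dots> = Comp PM N F G \<alpha> (HomZero PM N F)"
    by (rule hom_eqI[of _ N G])
      (simp_all add: zero_in_hom comp_in_hom N F G \<alpha> vect_hom_zero[OF hom_lin[OF \<alpha>] obj_vs obj_vs])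
  finally have "\<kappa> = HomZero PM N F"
    using m N \<kappa> zero_in_hom[OF N F] unfolding is_monic_def by blast
  then have ker: "\<alpha> p v = \<zero>\<^bsub>Fob G p\<^esub> \<Longrightarrow> v = \<zero>\<^bsub>Fob F p\<^esub>" if "v \<in> carrier (Fob F p)" for v
    using im that p by fastforce
  interpret FG: abelian_group "Fob F p" by (rule vs_abelian[OF obj_vs[OF F p]])
  interpret GG: abelian_group "Fob G p" by (rule vs_abelian[OF obj_vs[OF G p]])
  show ?thesis
  proof (rule inj_onI)
    fix u v assume uv: "u \<in> carrier (Fob F p)" "v \<in> carrier (Fob F p)" "\<alpha> p u = \<alpha> p v"
    then have "\<alpha> p (u \<ominus>\<^bsub>Fob F p\<^esub> v) = \<zero>\<^bsub>Fob G p\<^esub>"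
      using vect_hom_minus[OF hom_lin[OF \<alpha> p] obj_vs[OF F p] obj_vs[OF G p]] hom_closed[OF \<alpha> p] by simp
    then show "u = v" using ker[of "u \<ominus>\<^bsub>Fob F p\<^esub> v"] uv by simp
  qed
qed

text \<open>Dually, a cokernel \<open>\<pi>\<close> agrees with the zero map after
  \<open>\<alpha>\<close>, so it is zero, and the range of \<open>\<alpha>\<close>, being the kernel
  of \<open>\<pi>\<close>, is everything.\<close>

lemma epic_surjective:
  assumes F: "F \<in> Obj PM" and G: "G \<in> Obj PM" and e: "is_epic PM F G \<alpha>" and p: "p \<in> Field P"
  shows "\<alpha> p ` carrier (Fob F p) = carrier (Fob G p)"
proof -
  have \<alpha>: "\<alpha> \<in> Hom PM F G" using e by (simp add: is_epic_def)
  obtain Q \<pi> where Q\<pi>: "pointwise_cokernel F G \<alpha> Q \<pi>" using ex_pointwise_cokernel[OF F G \<alpha>] by blast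
  then have Q: "Q \<in> Obj PM" and \<pi>: "\<pi> \<in> Hom PM G Q"
    and ker: "{v \<in> carrier (Fob G p). \<pi> p v = \<zero>\<^bsub>Fob Q p\<^esub>} = \<alpha> p ` carrier (Fob F p)"
    using p by (auto simp: pointwise_cokernel_def)
  have "Comp PM F G Q \<pi> \<alpha> = HomZero PM F Q"
    using pointwise_cokernel_is_cokernel[OF F G \<alpha> Q\<pi>] by (simp add: is_cokernel_def)
  also have "\<dots> = Comp PM F G Q (HomZero PM G Q) \<alpha>"
    by (rule hom_eqI[of _ F Q]) (simp_all add: zero_in_hom comp_in_hom Q F G \<alpha> hom_closed[OF \<alpha>])
  finally have "\<pi> = HomZero PM G Q"
    using e Q \<pi> zero_in_hom[OF G Q] unfolding is_epic_def by blast
  moreover have "{v \<in> carrier (Fob G p). HomZero PM G Q p v = \<zero>\<^bsub>Fob Q p\<^esub>} = carrier (Fob G p)"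
    using p by auto
  ultimately show ?thesis using ker by simp
qed

lemma additive:
  assumes inf: "infinite (UNIV :: 'v set)"
  shows "additive_category (PM :: (('p, 'k, 'v) pers_module, 'p \<Rightarrow> 'v \<Rightarrow> 'v) add_cat)"
proof (rule additive_category.intro)
  show "preadditive_category (PM :: (('p, 'k, 'v) pers_module, 'p \<Rightarrow> 'v \<Rightarrow> 'v) add_cat)" by (rule preadditive)
  show "additive_category_axioms (PM :: (('p, 'k, 'v) pers_module, 'p \<Rightarrow> 'v \<Rightarrow> 'v) add_cat)"
  proof (rule additive_category_axioms.intro)
    obtain Z :: "('p, 'k, 'v) pers_module" where Z: "Z \<in> pfd_modules K P \<and>
      (\<forall>p \<in> Field P. carrier (Fob Z p) = {\<zero>\<^bsub>Fob Z p\<^esub>})" using ex_zero_module by (rule exE)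
    have "zero_object PM Z"
      by (rule zero_objectI) (use Z in \<open>simp_all add: pfd_modules_def\<close>)
    then show "\<exists>Z :: ('p, 'k, 'v) pers_module. zero_object PM Z" ..
  next
    fix F G :: "('p, 'k, 'v) pers_module" assume F: "F \<in> Obj PM" and G: "G \<in> Obj PM"
    show "\<exists>S. is_biproduct PM F G S" using ex_direct_sum[OF inf F G] by auto
  qed
qed

lemma abelian:
  assumes inf: "infinite (UNIV :: 'v set)"
  shows "abelian_category (PM :: (('p, 'k, 'v) pers_module, 'p \<Rightarrow> 'v \<Rightarrow> 'v) add_cat)"
proof (rule abelian_category.intro)
  show "additive_category (PM :: (('p, 'k, 'v) pers_module, 'p \<Rightarrow> 'v \<Rightarrow> 'v) add_cat)" using inf by (rule additive)
  show "abelian_category_axioms (PM :: (('p, 'k, 'v) pers_module, 'p \<Rightarrow> 'v \<Rightarrow> 'v) add_cat)"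
  proof (rule abelian_category_axioms.intro)
    fix F G :: "('p, 'k, 'v) pers_module" and \<alpha> assume F: "F \<in> Obj PM" and G: "G \<in> Obj PM"
    show "\<exists>N \<kappa>. is_kernel PM F G \<alpha> N \<kappa>" if \<alpha>: "\<alpha> \<in> Hom PM F G"
      using ex_pointwise_kernel[OF F G \<alpha>] pointwise_kernel_is_kernel[OF F G \<alpha>] by metis
    show "\<exists>Q \<pi>. is_cokernel PM F G \<alpha> Q \<pi>" if \<alpha>: "\<alpha> \<in> Hom PM F G"
      using ex_pointwise_cokernel[OF F G \<alpha>] pointwise_cokernel_is_cokernel[OF F G \<alpha>] by metis
    show "\<exists>Q \<in> Obj PM. \<exists>\<pi> \<in> Hom PM G Q. is_kernel PM G Q \<pi> F \<alpha>" if m: "is_monic PM F G \<alpha>"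
    proof -
      have \<alpha>: "\<alpha> \<in> Hom PM F G" using m by (simp add: is_monic_def)
      obtain Q \<pi> where Q\<pi>: "pointwise_cokernel F G \<alpha> Q \<pi>" using ex_pointwise_cokernel[OF F G \<alpha>] by metis
      then have Q: "Q \<in> Obj PM" and \<pi>: "\<pi> \<in> Hom PM G Q" by (simp_all add: pointwise_cokernel_def)
      \<comment> \<open>A monomorphism is the kernel of its cokernel: exactness at \<open>G\<close>
        is already part of \<open>pointwise_cokernel\<close>, and injectivity is all that has to be
        added.\<close>
      have "pointwise_kernel G Q \<pi> F \<alpha>"
        using Q\<pi> F \<alpha> monic_injective[OF F G m] by (simp add: pointwise_kernel_def pointwise_cokernel_def)
      then show ?thesis
        using pointwise_kernel_is_kernel[OF G Q \<pi>] Q \<pi> by (intro bexI)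
    qed
    show "\<exists>N \<in> Obj PM. \<exists>\<kappa> \<in> Hom PM N F. is_cokernel PM N F \<kappa> G \<alpha>" if e: "is_epic PM F G \<alpha>"
    proof -
      have \<alpha>: "\<alpha> \<in> Hom PM F G" using e by (simp add: is_epic_def)
      obtain N \<kappa> where N\<kappa>: "pointwise_kernel F G \<alpha> N \<kappa>" using ex_pointwise_kernel[OF F G \<alpha>] by metis
      then have N: "N \<in> Obj PM" and \<kappa>: "\<kappa> \<in> Hom PM N F" by (simp_all add: pointwise_kernel_def)
      \<comment> \<open>Dually, exactness at \<open>F\<close> comes from
        \<open>pointwise_kernel\<close>, and surjectivity is added.\<close>
      have "pointwise_cokernel N F \<kappa> G \<alpha>"
        using N\<kappa> G \<alpha> epic_surjective[OF F G e] by (simp add: pointwise_kernel_def pointwise_cokernel_def)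
      then show ?thesis
        using pointwise_cokernel_is_cokernel[OF N F \<kappa>] N \<kappa> by (intro bexI)
    qed
  qed
qed

end

section \<open>Precomposition with a poset map\<close>

lemma pullback_Fob [simp]: "Fob (Fob (pullback P e) F) p = Fob F (e p)"
  and pullback_Fob_Fmor [simp]: "Fmor (Fob (pullback P e) F) p q u = Fmor F (e p) (e q) ()"
  and pullback_Fmor: "Fmor (pullback P e) F G \<alpha> = (\<lambda>p \<in> Field P. \<alpha> (e p))"
  by (simp_all add: pullback_def precomp_functor_def comp_functor_def poset_functor_def poset_category_def)

lemma preadditive_full_subcategory:
  assumes "preadditive_category C" "B \<subseteq> Obj C"
  shows "preadditive_category (full_subcategory C B)"
proof -
  interpret preadditive_category C by fact
  have B: "a \<in> Obj C" if "a \<in> B" for a using that assms(2) by auto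
  have "hom_group (full_subcategory C B) a b = hom_group C a b" for a b
    by (simp add: hom_group_def full_subcategory_def)
  then show ?thesis
    by (intro preadditive_category.intro category.intro preadditive_category_axioms.intro)
      (simp_all add: full_subcategory_def B ident_hom comp_hom ident_left ident_right comp_assoc
        hom_comm_group comp_add_left comp_add_right)
qed

context persistence
begin

lemma isomorphicE:
  assumes "isomorphic PM F G" "F \<in> Obj PM" "G \<in> Obj PM"
  obtains \<phi> \<psi> where "\<phi> \<in> Hom PM F G" "\<psi> \<in> Hom PM G F"
    "\<And>p v. p \<in> Field P \<Longrightarrow> v \<in> carrier (Fob F p) \<Longrightarrow> \<psi> p (\<phi> p v) = v"
    "\<And>p v. p \<in> Field P \<Longrightarrow> v \<in> carrier (Fob G p) \<Longrightarrow> \<phi> p (\<psi> p v) = v"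
proof -
  obtain \<phi> \<psi> where *: "\<phi> \<in> Hom PM F G" "\<psi> \<in> Hom PM G F"
    "Comp PM F G F \<psi> \<phi> = Ident PM F" "Comp PM G F G \<phi> \<psi> = Ident PM G"
    using assms(1) unfolding isomorphic_def by auto
  show thesis
  proof (rule that[OF *(1,2)])
    fix p v assume "p \<in> Field P" "v \<in> carrier (Fob F p)"
    then show "\<psi> p (\<phi> p v) = v" using fun_cong[OF fun_cong[OF *(3), of p], of v] by simp
  next
    fix p v assume "p \<in> Field P" "v \<in> carrier (Fob G p)"
    then show "\<phi> p (\<psi> p v) = v" using fun_cong[OF fun_cong[OF *(4), of p], of v] by simp
  qed
qed

lemma isomorphicI:
  assumes "F \<in> Obj PM" "G \<in> Obj PM" "\<phi> \<in> Hom PM F G" "\<psi> \<in> Hom PM G F"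
    and "\<And>p v. p \<in> Field P \<Longrightarrow> v \<in> carrier (Fob F p) \<Longrightarrow> \<psi> p (\<phi> p v) = v"
    and "\<And>p v. p \<in> Field P \<Longrightarrow> v \<in> carrier (Fob G p) \<Longrightarrow> \<phi> p (\<psi> p v) = v"
  shows "isomorphic PM F G"
proof -
  have "Comp PM F G F \<psi> \<phi> = Ident PM F"
    by (rule hom_eqI[of _ F F]) (simp_all add: assms comp_in_hom ident_in_hom)
  moreover have "Comp PM G F G \<phi> \<psi> = Ident PM G"
    by (rule hom_eqI[of _ G G]) (simp_all add: assms comp_in_hom ident_in_hom)
  ultimately show ?thesis unfolding isomorphic_def using assms(3,4) by (intro bexI conjI)
qed

lemma isomorphic_refl:
  assumes "F \<in> Obj PM"
  shows "isomorphic PM F F"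
  by (rule isomorphicI[of F F "Ident PM F" "Ident PM F"]) (simp_all add: assms ident_in_hom)

text \<open>Modules are records of total functions. Two of them may agree on \<open>Field P\<close>
  and on comparable pairs and still differ as records through values elsewhere; this is the
  situation for a pullback along \<open>f i\<close> and the corresponding iterated pullback through
  \<open>e\<close>.\<close>

lemma isomorphic_cong:
  assumes iso: "isomorphic PM F G" and F: "F \<in> Obj PM" and G: "G \<in> Obj PM" and G': "G' \<in> Obj PM"
    and ob: "\<And>p. p \<in> Field P \<Longrightarrow> Fob G' p = Fob G p"
    and mor: "\<And>p q. (p, q) \<in> P \<Longrightarrow> Fmor G' p q () = Fmor G p q ()"
  shows "isomorphic PM F G'"
proof -
  obtain \<phi> \<psi> where *: "\<phi> \<in> Hom PM F G" "\<psi> \<in> Hom PM G F"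
    "\<And>p v. p \<in> Field P \<Longrightarrow> v \<in> carrier (Fob F p) \<Longrightarrow> \<psi> p (\<phi> p v) = v"
    "\<And>p v. p \<in> Field P \<Longrightarrow> v \<in> carrier (Fob G p) \<Longrightarrow> \<phi> p (\<psi> p v) = v"
    using isomorphicE[OF iso F G] by metis
  have "\<phi> \<in> Hom PM F G'" "\<psi> \<in> Hom PM G' F"
    using *(1,2) by (auto simp: hom_iff ob mor FieldI1 FieldI2)
  then show ?thesis
    by (rule isomorphicI[OF F G']) (simp_all add: * ob)
qed

lemma biproductE:
  fixes F G S :: "('p, 'k, 'v) pers_module"
  assumes "is_biproduct PM F G S"
  obtains i j f g where "S \<in> Obj PM"
    "i \<in> Hom PM F S" "j \<in> Hom PM G S" "f \<in> Hom PM S F" "g \<in> Hom PM S G"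
    "\<And>p v. p \<in> Field P \<Longrightarrow> v \<in> carrier (Fob F p) \<Longrightarrow> f p (i p v) = v"
    "\<And>p v. p \<in> Field P \<Longrightarrow> v \<in> carrier (Fob G p) \<Longrightarrow> g p (j p v) = v"
    "\<And>p v. p \<in> Field P \<Longrightarrow> v \<in> carrier (Fob F p) \<Longrightarrow> g p (i p v) = \<zero>\<^bsub>Fob G p\<^esub>"
    "\<And>p v. p \<in> Field P \<Longrightarrow> v \<in> carrier (Fob G p) \<Longrightarrow> f p (j p v) = \<zero>\<^bsub>Fob F p\<^esub>"
    "\<And>p s. p \<in> Field P \<Longrightarrow> s \<in> carrier (Fob S p) \<Longrightarrow> i p (f p s) \<oplus>\<^bsub>Fob S p\<^esub> j p (g p s) = s"
proof -
  obtain i j f g where *: "S \<in> Obj PM"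
    "i \<in> Hom PM F S" "j \<in> Hom PM G S" "f \<in> Hom PM S F" "g \<in> Hom PM S G"
    and eq: "Comp PM F S F f i = Ident PM F" "Comp PM G S G g j = Ident PM G"
      "Comp PM F S G g i = HomZero PM F G" "Comp PM G S F f j = HomZero PM G F"
      "HomAdd PM S S (Comp PM S F S i f) (Comp PM S G S j g) = Ident PM S"
    using assms unfolding is_biproduct_def by auto
  note eq = eq[THEN fun_cong, THEN fun_cong]
  show thesis
  proof (rule that[OF *])
    fix p v assume "p \<in> Field P" "v \<in> carrier (Fob F p)"
    then show "f p (i p v) = v" "g p (i p v) = \<zero>\<^bsub>Fob G p\<^esub>"
      using eq(1)[of p v] eq(3)[of p v] by simp_all
  next
    fix p v assume "p \<in> Field P" "v \<in> carrier (Fob G p)"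
    then show "g p (j p v) = v" "f p (j p v) = \<zero>\<^bsub>Fob F p\<^esub>"
      using eq(2)[of p v] eq(4)[of p v] by simp_all
  next
    fix p s assume "p \<in> Field P" "s \<in> carrier (Fob S p)"
    then show "i p (f p s) \<oplus>\<^bsub>Fob S p\<^esub> j p (g p s) = s"
      using eq(5)[of p s] by simp
  qed
qed

end

locale persistence_pullback = persistence K P + target: persistence K Q
  for K :: "('k, 'r) ring_scheme" and P :: "'p rel" and Q :: "'q rel" +
  fixes e :: "'p \<Rightarrow> 'q"
  assumes map: "poset_map P Q e"
begin

lemma e_Field: "p \<in> Field P \<Longrightarrow> e p \<in> Field Q"
  and e_mono: "(p, q) \<in> P \<Longrightarrow> (e p, e q) \<in> Q"
  using map by (auto simp: poset_map_def)

lemma pullback_obj: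
  assumes F: "F \<in> Obj target.PM"
  shows "Fob (pullback P e) F \<in> Obj PM"
  by (rule objI) (simp_all add: target.obj_vs[OF F] target.obj_mor[OF F] target.obj_ident[OF F]
      target.obj_comp[OF F e_mono e_mono] e_Field e_mono)

lemma pullback_pfd:
  "F \<in> pfd_modules K Q \<Longrightarrow> Fob (pullback P e) F \<in> pfd_modules K P"
  by (simp add: pfd_modules_def pullback_obj e_Field)

lemma pullback_hom:
  assumes "\<alpha> \<in> Hom target.PM F G"
  shows "Fmor (pullback P e) F G \<alpha> \<in> Hom PM (Fob (pullback P e) F) (Fob (pullback P e) G)"
  by (rule homI) (simp_all add: pullback_Fmor target.hom_lin[OF assms] target.hom_nat[OF assms] e_Field e_mono)

lemma pullback_is_functor:
  "is_functor (target.PM :: (('q, 'k, 'v) pers_module, 'q \<Rightarrow> 'v \<Rightarrow> 'v) add_cat) PM (pullback P e)"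
  unfolding is_functor_def
proof (intro conjI ballI)
  fix F :: "('q, 'k, 'v) pers_module" assume F: "F \<in> Obj target.PM"
  show "Fob (pullback P e) F \<in> Obj PM" using F by (rule pullback_obj)
  show "Fmor (pullback P e) F F (Ident target.PM F) = Ident PM (Fob (pullback P e) F)"
    by (rule hom_eqI[OF pullback_hom[OF target.ident_in_hom[OF F]] ident_in_hom[OF pullback_obj[OF F]]])
      (simp add: pullback_Fmor e_Field)
next
  fix F G :: "('q, 'k, 'v) pers_module" and \<alpha> assume "\<alpha> \<in> Hom target.PM F G"
  then show "Fmor (pullback P e) F G \<alpha> \<in> Hom PM (Fob (pullback P e) F) (Fob (pullback P e) G)"
    by (rule pullback_hom)
next
  fix F G H :: "('q, 'k, 'v) pers_module" and \<alpha> \<beta>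
  assume F: "F \<in> Obj target.PM" and \<alpha>: "\<alpha> \<in> Hom target.PM F G" and \<beta>: "\<beta> \<in> Hom target.PM G H"
  show "Fmor (pullback P e) F H (Comp target.PM F G H \<beta> \<alpha>) =
      Comp PM (Fob (pullback P e) F) (Fob (pullback P e) G) (Fob (pullback P e) H)
        (Fmor (pullback P e) G H \<beta>) (Fmor (pullback P e) F G \<alpha>)"
    by (rule hom_eqI[OF pullback_hom[OF target.comp_in_hom[OF \<alpha> \<beta> F]]
          comp_in_hom[OF pullback_hom[OF \<alpha>] pullback_hom[OF \<beta>] pullback_obj[OF F]]])
      (simp add: pullback_Fmor e_Field)
qed

end

text \<open>The assumptions match the parts of full faithfulness: \<open>surj\<close> gives
  faithfulness, \<open>fibers_connected\<close> makes a transformation descend to a family on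
  \<open>Q\<close>, and \<open>generated\<close> makes that family natural. The inclusion opposite
  to \<open>generated\<close> follows from monotonicity of \<open>e\<close> and transitivity of
  \<open>Q\<close>.\<close>

locale connected_quotient = persistence_pullback K P Q e
  for K :: "('k, 'r) ring_scheme" and P :: "'p rel" and Q :: "'q rel" and e :: "'p \<Rightarrow> 'q" +
  assumes surj: "e ` Field P = Field Q"
    and fibers_connected: "\<lbrakk>p \<in> Field P; q \<in> Field P; e p = e q\<rbrakk>
      \<Longrightarrow> (p, q) \<in> ((P \<union> P\<inverse>) \<inter> {(x, y). e x = e y})\<^sup>*"
    and generated: "Q \<subseteq> ((\<lambda>(p, q). (e p, e q)) ` P)\<^sup>+"
begin

lemma generated_le:
  assumes "(x, y) \<in> ((\<lambda>(p, q). (e p, e q)) ` P)\<^sup>+"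
  shows "(x, y) \<in> Q"
proof -
  have "trans Q" using target.P_trans by (rule transI)
  moreover have "(x, y) \<in> Q\<^sup>+" by (rule trancl_mono[OF assms]) (use e_mono in auto)
  ultimately show ?thesis by simp
qed

lemma pullback_faithful:
  assumes "\<alpha> \<in> Hom target.PM F G" "\<beta> \<in> Hom target.PM F G"
    and eq: "Fmor (pullback P e) F G \<alpha> = Fmor (pullback P e) F G \<beta>"
  shows "\<alpha> = \<beta>"
proof (rule extensionalityI[OF target.hom_ext[OF assms(1)] target.hom_ext[OF assms(2)]])
  fix x assume "x \<in> Field Q"
  then obtain p where "p \<in> Field P" "x = e p" using surj by blast
  then show "\<alpha> x = \<beta> x" using fun_cong[OF eq, of p] by (simp add: pullback_Fmor)
qed

lemma pullback_full:
  assumes F: "F \<in> Obj target.PM" and G: "G \<in> Obj target.PM"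
    and \<alpha>: "\<alpha> \<in> Hom PM (Fob (pullback P e) F) (Fob (pullback P e) G)"
  shows "\<exists>\<beta> \<in> Hom target.PM F G. Fmor (pullback P e) F G \<beta> = \<alpha>"
proof -
  have step: "\<alpha> p = \<alpha> q" if pq: "(p, q) \<in> P" "e p = e q" for p q
  proof -
    have p: "p \<in> Field P" and q: "q \<in> Field P" using pq by (auto simp: FieldI1 FieldI2)
    show ?thesis
    proof (rule extensionalityI)
      show "\<alpha> p \<in> extensional (carrier (Fob F (e p)))" using vect_homD(1)[OF hom_lin[OF \<alpha> p]] by simp
      show "\<alpha> q \<in> extensional (carrier (Fob F (e p)))" using vect_homD(1)[OF hom_lin[OF \<alpha> q]] pq by simp
      fix v assume v: "v \<in> carrier (Fob F (e p))"
      then have "\<alpha> q (Fmor F (e p) (e p) () v) = Fmor G (e p) (e p) () (\<alpha> p v)"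
        using hom_nat[OF \<alpha> pq(1), of v] pq(2) by simp
      then show "\<alpha> p v = \<alpha> q v"
        using v hom_closed[OF \<alpha> p, of v] e_Field[OF p] by (simp add: target.obj_ident[OF F] target.obj_ident[OF G])
    qed
  qed
  have const: "\<alpha> p = \<alpha> q" if "p \<in> Field P" "q \<in> Field P" "e p = e q" for p q
    using fibers_connected[OF that]
  proof induction
    case (step y z)
    then show ?case using \<open>\<And>p q. (p, q) \<in> P \<Longrightarrow> e p = e q \<Longrightarrow> \<alpha> p = \<alpha> q\<close> by force
  qed simp
  \<comment> \<open>The value at \<open>x\<close> is read off at an arbitrary preimage; by
    \<open>const\<close> every other preimage gives the same map.\<close>
  define \<beta> where "\<beta> = (\<lambda>x \<in> Field Q. \<alpha> (inv_into (Field P) e x))"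
  have \<beta>: "\<beta> (e p) = \<alpha> p" if p: "p \<in> Field P" for p
    using const[of "inv_into (Field P) e (e p)" p] p e_Field[OF p]
    by (simp add: \<beta>_def f_inv_into_f inv_into_into)
  have \<beta>_lin: "\<beta> x \<in> Hom (vect K) (Fob F x) (Fob G x)" if "x \<in> Field Q" for x
    using that hom_lin[OF \<alpha>] unfolding surj[symmetric] by (auto simp: \<beta>)
  \<comment> \<open>Induction along a chain of images of comparable pairs. Consecutive pairs of the
    chain meet only in \<open>Q\<close>: the upper element of one and the lower element of the next
    merely have the same image. Since \<open>\<beta>\<close> depends only on the image, the
    naturality squares of \<open>\<alpha>\<close> can nevertheless be pasted.\<close>
  have nat: "\<beta> y (Fmor F x y () v) = Fmor G x y () (\<beta> x v)" if "(x, y) \<in> Q" "v \<in> carrier (Fob F x)" for x y v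
    using subsetD[OF generated that(1)] that(2)
  proof induction
    case (base y)
    then obtain p q where *: "(p, q) \<in> P" "x = e p" "y = e q" by auto
    then show ?case using hom_nat[OF \<alpha> *(1), of v] base by (simp add: \<beta> FieldI1 FieldI2)
  next
    case (step y z)
    then obtain p q where *: "(p, q) \<in> P" "y = e p" "z = e q" by auto
    have yz: "(y, z) \<in> Q" using * e_mono by simp
    have xy: "(x, y) \<in> Q" using step(1) by (rule generated_le)
    have v: "Fmor F x y () v \<in> carrier (Fob F y)" using target.obj_mor_closed[OF F xy] step by simp
    have "\<beta> z (Fmor F y z () (Fmor F x y () v)) = Fmor G y z () (\<beta> y (Fmor F x y () v))"
      using hom_nat[OF \<alpha> *(1), of "Fmor F x y () v"] * v by (simp add: \<beta> FieldI1 FieldI2)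
    then show ?case
      using step vect_homD(2)[OF \<beta>_lin, of x v] xy
      by (simp add: target.obj_comp[OF F xy yz] target.obj_comp[OF G xy yz] FieldI1)
  qed
  have "\<beta> \<in> Hom target.PM F G"
    by (rule target.homI) (simp_all add: \<beta>_lin nat, simp add: \<beta>_def)
  moreover have "Fmor (pullback P e) F G \<beta> = \<alpha>"
    by (rule extensionalityI[OF _ hom_ext[OF \<alpha>]]) (simp_all add: pullback_Fmor \<beta>)
  ultimately show ?thesis by blast
qed

lemma pullback_fully_faithful:
  "fully_faithful (target.PM :: (('q, 'k, 'v) pers_module, 'q \<Rightarrow> 'v \<Rightarrow> 'v) add_cat) PM (pullback P e)"
  unfolding fully_faithful_def
proof (intro conjI ballI pullback_is_functor)
  fix F G :: "('q, 'k, 'v) pers_module" assume F: "F \<in> Obj target.PM" and G: "G \<in> Obj target.PM"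
  show "bij_betw (Fmor (pullback P e) F G) (Hom target.PM F G)
      (Hom PM (Fob (pullback P e) F) (Fob (pullback P e) G))"
    unfolding bij_betw_def
  proof (intro conjI equalityI subsetI)
    show "inj_on (Fmor (pullback P e) F G) (Hom target.PM F G)"
      by (rule inj_onI) (rule pullback_faithful)
    fix \<alpha> assume "\<alpha> \<in> Hom PM (Fob (pullback P e) F) (Fob (pullback P e) G)"
    then show "\<alpha> \<in> Fmor (pullback P e) F G ` Hom target.PM F G"
      using pullback_full[OF F G, of \<alpha>] by (auto simp: image_iff)
  qed (use pullback_hom in auto)
qed

section \<open>Closure of the essential image under kernels, cokernels and direct sums\<close>

abbreviation ess_image :: "('p, 'k, 'v) pers_module set" where
  "ess_image \<equiv> essential_image PM (pullback P e) (pfd_modules K Q)"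

lemma ess_imageE:
  assumes "A \<in> ess_image"
  obtains F \<phi> \<psi> where "A \<in> Obj PM" "F \<in> pfd_modules K Q" "F \<in> Obj target.PM"
    "\<phi> \<in> Hom PM A (Fob (pullback P e) F)" "\<psi> \<in> Hom PM (Fob (pullback P e) F) A"
    "\<And>p v. p \<in> Field P \<Longrightarrow> v \<in> carrier (Fob A p) \<Longrightarrow> \<psi> p (\<phi> p v) = v"
    "\<And>p v. p \<in> Field P \<Longrightarrow> v \<in> carrier (Fob F (e p)) \<Longrightarrow> \<phi> p (\<psi> p v) = v"
proof -
  obtain F where F: "A \<in> Obj PM" "F \<in> pfd_modules K Q" "isomorphic PM A (Fob (pullback P e) F)"
    using assms by (auto simp: essential_image_def)
  then have F': "F \<in> Obj target.PM" by (simp add: pfd_modules_def)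
  show thesis
  proof (rule isomorphicE[OF F(3,1) pullback_obj[OF F']])
    fix \<phi> \<psi> assume "\<phi> \<in> Hom PM A (Fob (pullback P e) F)" "\<psi> \<in> Hom PM (Fob (pullback P e) F) A"
      "\<And>p v. p \<in> Field P \<Longrightarrow> v \<in> carrier (Fob A p) \<Longrightarrow> \<psi> p (\<phi> p v) = v"
      "\<And>p v. p \<in> Field P \<Longrightarrow> v \<in> carrier (Fob (Fob (pullback P e) F) p) \<Longrightarrow> \<phi> p (\<psi> p v) = v"
    then show thesis using that[OF F(1,2) F'] by simp
  qed
qed

lemma pullback_in_ess_image:
  assumes "F \<in> pfd_modules K Q"
  shows "Fob (pullback P e) F \<in> ess_image"
proof -
  have "F \<in> Obj target.PM" using assms by (simp add: pfd_modules_def)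
  then show ?thesis
    using assms isomorphic_refl[OF pullback_obj] pullback_obj by (auto simp: essential_image_def)
qed

text \<open>Conjugating \<open>\<alpha>\<close> with the isomorphisms to pullbacks gives a map of
  pullbacks, which by fullness comes from some \<open>g\<close> over \<open>Q\<close>. The pullback
  of a kernel or cokernel of \<open>g\<close> is one of \<open>\<alpha>\<close>, once the
  isomorphisms are composed back in.\<close>

lemma ess_image_kernel_cokernel:
  assumes A: "A \<in> ess_image" and B: "B \<in> ess_image" and \<alpha>: "\<alpha> \<in> Hom PM A B"
  shows "(\<exists>N \<in> ess_image. \<exists>\<kappa>. is_kernel PM A B \<alpha> N \<kappa>) \<and> (\<exists>C \<in> ess_image. \<exists>\<pi>. is_cokernel PM A B \<alpha> C \<pi>)"
proof -
  obtain F \<phi> \<psi> where AO: "A \<in> Obj PM" and F: "F \<in> pfd_modules K Q" "F \<in> Obj target.PM"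
    and \<phi>: "\<phi> \<in> Hom PM A (Fob (pullback P e) F)" and \<psi>: "\<psi> \<in> Hom PM (Fob (pullback P e) F) A"
    and \<psi>\<phi>: "\<And>p v. p \<in> Field P \<Longrightarrow> v \<in> carrier (Fob A p) \<Longrightarrow> \<psi> p (\<phi> p v) = v"
    and \<phi>\<psi>: "\<And>p v. p \<in> Field P \<Longrightarrow> v \<in> carrier (Fob F (e p)) \<Longrightarrow> \<phi> p (\<psi> p v) = v"
    using ess_imageE[OF A] by metis
  obtain G \<phi>' \<psi>' where BO: "B \<in> Obj PM" and G: "G \<in> pfd_modules K Q" "G \<in> Obj target.PM"
    and \<phi>': "\<phi>' \<in> Hom PM B (Fob (pullback P e) G)" and \<psi>': "\<psi>' \<in> Hom PM (Fob (pullback P e) G) B"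
    and \<psi>\<phi>': "\<And>p v. p \<in> Field P \<Longrightarrow> v \<in> carrier (Fob B p) \<Longrightarrow> \<psi>' p (\<phi>' p v) = v"
    and \<phi>\<psi>': "\<And>p v. p \<in> Field P \<Longrightarrow> v \<in> carrier (Fob G (e p)) \<Longrightarrow> \<phi>' p (\<psi>' p v) = v"
    using ess_imageE[OF B] by metis
  note FO = pullback_obj[OF F(2)] and GO = pullback_obj[OF G(2)]
  note closed = hom_closed[OF \<phi>, simplified] hom_closed[OF \<psi>, simplified]
    hom_closed[OF \<phi>', simplified] hom_closed[OF \<psi>', simplified] hom_closed[OF \<alpha>]
  have "Comp PM (Fob (pullback P e) F) B (Fob (pullback P e) G) \<phi>' (Comp PM (Fob (pullback P e) F) A B \<alpha> \<psi>)
      \<in> Hom PM (Fob (pullback P e) F) (Fob (pullback P e) G)" (is "?h \<in> _")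
    by (intro comp_in_hom \<alpha> \<psi> \<phi>' FO)
  then obtain g where g: "g \<in> Hom target.PM F G" "Fmor (pullback P e) F G g = ?h"
    using pullback_full[OF F(2) G(2)] by metis
  have g_apply: "g (e p) v = \<phi>' p (\<alpha> p (\<psi> p v))" if "p \<in> Field P" "v \<in> carrier (Fob F (e p))" for p v
    using fun_cong[OF fun_cong[OF g(2), of p], of v] that by (simp add: pullback_Fmor)
  have \<phi>'0: "\<phi>' p \<zero>\<^bsub>Fob B p\<^esub> = \<zero>\<^bsub>Fob G (e p)\<^esub>" if "p \<in> Field P" for p
    using vect_hom_zero[OF hom_lin[OF \<phi>' that] obj_vs[OF BO that] obj_vs[OF GO that]] by simp
  \<comment> \<open>\<open>\<phi>'\<close> is injective, so \<open>g\<close> vanishes exactly where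
    \<open>\<alpha>\<close> vanishes after \<open>\<psi>\<close>.\<close>
  have \<phi>'_zero: "\<phi>' p w = \<zero>\<^bsub>Fob G (e p)\<^esub> \<longleftrightarrow> w = \<zero>\<^bsub>Fob B p\<^esub>" if "p \<in> Field P" "w \<in> carrier (Fob B p)" for p w
    using \<phi>'0[OF that(1)] vect_hom_zero[OF hom_lin[OF \<psi>'] obj_vs[OF GO] obj_vs[OF BO], of p]
      that \<psi>\<phi>'[OF that] by auto
  obtain N \<kappa> where N\<kappa>: "target.pointwise_kernel F G g N \<kappa>" and N: "N \<in> pfd_modules K Q"
    using target.ex_pointwise_kernel[OF F(2) G(2) g(1)] F(1) by metis
  then have NO: "N \<in> Obj target.PM" and \<kappa>: "\<kappa> \<in> Hom target.PM N F"
    and \<kappa>_inj: "x \<in> Field Q \<Longrightarrow> inj_on (\<kappa> x) (carrier (Fob N x))"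
    and \<kappa>_im: "x \<in> Field Q \<Longrightarrow> \<kappa> x ` carrier (Fob N x) = {v \<in> carrier (Fob F x). g x v = \<zero>\<^bsub>Fob G x\<^esub>}" for x
    by (simp_all add: target.pointwise_kernel_def)
  define \<kappa>' where "\<kappa>' = Comp PM (Fob (pullback P e) N) (Fob (pullback P e) F) A \<psi> (Fmor (pullback P e) N F \<kappa>)"
  have \<kappa>'_apply: "\<kappa>' p v = \<psi> p (\<kappa> (e p) v)" if "p \<in> Field P" "v \<in> carrier (Fob N (e p))" for p v
    using that by (simp add: \<kappa>'_def pullback_Fmor)
  have "pointwise_kernel A B \<alpha> (Fob (pullback P e) N) \<kappa>'"
    unfolding pointwise_kernel_def
  proof (intro conjI ballI)
    show "\<kappa>' \<in> Hom PM (Fob (pullback P e) N) A"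
      unfolding \<kappa>'_def by (intro comp_in_hom pullback_hom \<kappa> \<psi> pullback_obj NO)
    fix p assume p: "p \<in> Field P"
    have \<kappa>_closed: "\<kappa> (e p) v \<in> carrier (Fob F (e p))" if "v \<in> carrier (Fob N (e p))" for v
      using target.hom_closed[OF \<kappa> e_Field[OF p] that] .
    show "inj_on (\<kappa>' p) (carrier (Fob (Fob (pullback P e) N) p))"
      using inj_onD[OF \<kappa>_inj[OF e_Field[OF p]]] \<phi>\<psi>[OF p] \<kappa>_closed
      by (intro inj_onI) (metis \<kappa>'_apply p pullback_Fob)
    have "\<kappa>' p ` carrier (Fob N (e p)) = \<psi> p ` {v \<in> carrier (Fob F (e p)). g (e p) v = \<zero>\<^bsub>Fob G (e p)\<^esub>}"
      unfolding \<kappa>_im[OF e_Field[OF p], symmetric] image_image using p by (simp add: \<kappa>'_apply)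
    also have "\<dots> = {v \<in> carrier (Fob A p). \<alpha> p v = \<zero>\<^bsub>Fob B p\<^esub>}"
    proof (intro equalityI subsetI)
      fix v assume "v \<in> \<psi> p ` {v \<in> carrier (Fob F (e p)). g (e p) v = \<zero>\<^bsub>Fob G (e p)\<^esub>}"
      then show "v \<in> {v \<in> carrier (Fob A p). \<alpha> p v = \<zero>\<^bsub>Fob B p\<^esub>}"
        using p closed by (auto simp: g_apply \<phi>'_zero)
    next
      fix v assume "v \<in> {v \<in> carrier (Fob A p). \<alpha> p v = \<zero>\<^bsub>Fob B p\<^esub>}"
      then show "v \<in> \<psi> p ` {v \<in> carrier (Fob F (e p)). g (e p) v = \<zero>\<^bsub>Fob G (e p)\<^esub>}"
        using p closed by (intro image_eqI[of _ _ "\<phi> p v"]) (auto simp: g_apply \<psi>\<phi> \<phi>'0)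
    qed
    finally show "\<kappa>' p ` carrier (Fob (Fob (pullback P e) N) p) = {v \<in> carrier (Fob A p). \<alpha> p v = \<zero>\<^bsub>Fob B p\<^esub>}"
      by simp
  qed (rule pullback_obj[OF NO])
  then have 1: "is_kernel PM A B \<alpha> (Fob (pullback P e) N) \<kappa>'"
    by (rule pointwise_kernel_is_kernel[OF AO BO \<alpha>])
  obtain C \<pi> where C\<pi>: "target.pointwise_cokernel F G g C \<pi>" and C: "C \<in> pfd_modules K Q"
    using target.ex_pointwise_cokernel[OF F(2) G(2) g(1)] G(1) by metis
  then have CO: "C \<in> Obj target.PM" and \<pi>: "\<pi> \<in> Hom target.PM G C"
    and \<pi>_surj: "x \<in> Field Q \<Longrightarrow> \<pi> x ` carrier (Fob G x) = carrier (Fob C x)"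
    and \<pi>_ker: "x \<in> Field Q \<Longrightarrow> {w \<in> carrier (Fob G x). \<pi> x w = \<zero>\<^bsub>Fob C x\<^esub>} = g x ` carrier (Fob F x)" for x
    by (simp_all add: target.pointwise_cokernel_def)
  define \<pi>' where "\<pi>' = Comp PM B (Fob (pullback P e) G) (Fob (pullback P e) C) (Fmor (pullback P e) G C \<pi>) \<phi>'"
  have \<pi>'_apply: "\<pi>' p v = \<pi> (e p) (\<phi>' p v)" if "p \<in> Field P" "v \<in> carrier (Fob B p)" for p v
    using that by (simp add: \<pi>'_def pullback_Fmor)
  have "pointwise_cokernel A B \<alpha> (Fob (pullback P e) C) \<pi>'"
    unfolding pointwise_cokernel_def
  proof (intro conjI ballI)
    show "\<pi>' \<in> Hom PM B (Fob (pullback P e) C)"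
      unfolding \<pi>'_def by (intro comp_in_hom[OF \<phi>'] pullback_hom \<pi> BO)
    fix p assume p: "p \<in> Field P"
    have "\<phi>' p ` carrier (Fob B p) = carrier (Fob G (e p))"
    proof (intro equalityI subsetI)
      fix w assume "w \<in> carrier (Fob G (e p))"
      then show "w \<in> \<phi>' p ` carrier (Fob B p)"
        using p closed \<phi>\<psi>' by (intro image_eqI[of _ _ "\<psi>' p w"]) simp_all
    qed (use p closed in auto)
    then have "\<pi>' p ` carrier (Fob B p) = carrier (Fob C (e p))"
      using \<pi>_surj[OF e_Field[OF p]] p by (simp add: \<pi>'_apply flip: image_image)
    then show "\<pi>' p ` carrier (Fob B p) = carrier (Fob (Fob (pullback P e) C) p)" by simp
    show "{w \<in> carrier (Fob B p). \<pi>' p w = \<zero>\<^bsub>Fob (Fob (pullback P e) C) p\<^esub>} = \<alpha> p ` carrier (Fob A p)"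
    proof (intro equalityI subsetI)
      fix w assume w: "w \<in> {w \<in> carrier (Fob B p). \<pi>' p w = \<zero>\<^bsub>Fob (Fob (pullback P e) C) p\<^esub>}"
      then have "\<phi>' p w \<in> g (e p) ` carrier (Fob F (e p))"
        unfolding \<pi>_ker[OF e_Field[OF p], symmetric] using p w closed by (auto simp: \<pi>'_apply)
      then obtain v where v: "v \<in> carrier (Fob F (e p))" "\<phi>' p w = g (e p) v" by blast
      \<comment> \<open>Here \<open>g\<close> is \<open>\<alpha>\<close> conjugated, so
        \<open>\<phi>' p w\<close> equals \<open>\<phi>' p (\<alpha> p (\<psi> p v))\<close>;
        applying \<open>\<psi>'\<close> cancels \<open>\<phi>'\<close>.\<close>
      then have "w = \<alpha> p (\<psi> p v)"
        using w p closed by (metis (lifting) \<psi>\<phi>' g_apply mem_Collect_eq)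
      then show "w \<in> \<alpha> p ` carrier (Fob A p)" using v p closed by simp
    next
      fix w assume "w \<in> \<alpha> p ` carrier (Fob A p)"
      then obtain v where v: "v \<in> carrier (Fob A p)" "w = \<alpha> p v" by blast
      have "g (e p) (\<phi> p v) \<in> g (e p) ` carrier (Fob F (e p))" using v p closed by simp
      then show "w \<in> {w \<in> carrier (Fob B p). \<pi>' p w = \<zero>\<^bsub>Fob (Fob (pullback P e) C) p\<^esub>}"
        unfolding \<pi>_ker[OF e_Field[OF p], symmetric] using v p closed by (simp add: \<pi>'_apply g_apply \<psi>\<phi>)
    qed
  qed (rule pullback_obj[OF CO])
  then have 2: "is_cokernel PM A B \<alpha> (Fob (pullback P e) C) \<pi>'"
    by (rule pointwise_cokernel_is_cokernel[OF AO BO \<alpha>])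
  show ?thesis using 1 2 pullback_in_ess_image[OF N] pullback_in_ess_image[OF C] by (intro conjI bexI exI)
qed

text \<open>The sum of \<open>F\<close> and \<open>G\<close> is taken over \<open>Q\<close> and
  pulled back; its injections and projections become those for \<open>A\<close> and \<open>B\<close>
  after composition with the isomorphisms. The biproduct equations hold at \<open>p\<close> because
  they hold at \<open>e p\<close>.\<close>

lemma ess_image_biproduct:
  fixes A B :: "('p, 'k, 'v) pers_module"
  assumes inf: "infinite (UNIV :: 'v set)" and A: "A \<in> ess_image" and B: "B \<in> ess_image"
  shows "\<exists>S \<in> ess_image. is_biproduct PM A B S"
proof -
  obtain F \<phi> \<psi> where AO: "A \<in> Obj PM" and F: "F \<in> pfd_modules K Q" "F \<in> Obj target.PM"
    and \<phi>: "\<phi> \<in> Hom PM A (Fob (pullback P e) F)" and \<psi>: "\<psi> \<in> Hom PM (Fob (pullback P e) F) A"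
    and \<psi>\<phi>: "\<And>p v. p \<in> Field P \<Longrightarrow> v \<in> carrier (Fob A p) \<Longrightarrow> \<psi> p (\<phi> p v) = v"
    and \<phi>\<psi>: "\<And>p v. p \<in> Field P \<Longrightarrow> v \<in> carrier (Fob F (e p)) \<Longrightarrow> \<phi> p (\<psi> p v) = v"
    using ess_imageE[OF A] by metis
  obtain G \<phi>' \<psi>' where BO: "B \<in> Obj PM" and G: "G \<in> pfd_modules K Q" "G \<in> Obj target.PM"
    and \<phi>': "\<phi>' \<in> Hom PM B (Fob (pullback P e) G)" and \<psi>': "\<psi>' \<in> Hom PM (Fob (pullback P e) G) B"
    and \<psi>\<phi>': "\<And>p v. p \<in> Field P \<Longrightarrow> v \<in> carrier (Fob B p) \<Longrightarrow> \<psi>' p (\<phi>' p v) = v"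
    and \<phi>\<psi>': "\<And>p v. p \<in> Field P \<Longrightarrow> v \<in> carrier (Fob G (e p)) \<Longrightarrow> \<phi>' p (\<psi>' p v) = v"
    using ess_imageE[OF B] by metis
  obtain S where FGS: "is_biproduct target.PM F G S" and S: "S \<in> pfd_modules K Q"
    using target.ex_direct_sum[OF inf F(2) G(2)] F(1) G(1) by metis
  obtain i j f g where SO: "S \<in> Obj target.PM"
    and i: "i \<in> Hom target.PM F S" and j: "j \<in> Hom target.PM G S"
    and f: "f \<in> Hom target.PM S F" and g: "g \<in> Hom target.PM S G"
    and eqs: "\<And>x v. x \<in> Field Q \<Longrightarrow> v \<in> carrier (Fob F x) \<Longrightarrow> f x (i x v) = v"
      "\<And>x v. x \<in> Field Q \<Longrightarrow> v \<in> carrier (Fob G x) \<Longrightarrow> g x (j x v) = v"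
      "\<And>x v. x \<in> Field Q \<Longrightarrow> v \<in> carrier (Fob F x) \<Longrightarrow> g x (i x v) = \<zero>\<^bsub>Fob G x\<^esub>"
      "\<And>x v. x \<in> Field Q \<Longrightarrow> v \<in> carrier (Fob G x) \<Longrightarrow> f x (j x v) = \<zero>\<^bsub>Fob F x\<^esub>"
      "\<And>x s. x \<in> Field Q \<Longrightarrow> s \<in> carrier (Fob S x) \<Longrightarrow> i x (f x s) \<oplus>\<^bsub>Fob S x\<^esub> j x (g x s) = s"
    by (rule target.biproductE[OF FGS]) (rule that)
  note closed = hom_closed[OF \<phi>, simplified] hom_closed[OF \<psi>, simplified]
    hom_closed[OF \<phi>', simplified] hom_closed[OF \<psi>', simplified]
    target.hom_closed[OF i] target.hom_closed[OF j] target.hom_closed[OF f] target.hom_closed[OF g]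
  note FO = pullback_obj[OF F(2)] and GO = pullback_obj[OF G(2)]
  let ?E = "Fob (pullback P e)"
  have "is_biproduct PM A B (?E S)"
  proof (rule biproductI[OF AO BO pullback_obj[OF SO],
        of "Comp PM A (?E F) (?E S) (Fmor (pullback P e) F S i) \<phi>"
           "Comp PM B (?E G) (?E S) (Fmor (pullback P e) G S j) \<phi>'"
           "Comp PM (?E S) (?E F) A \<psi> (Fmor (pullback P e) S F f)"
           "Comp PM (?E S) (?E G) B \<psi>' (Fmor (pullback P e) S G g)"])
    fix p v assume p: "p \<in> Field P" "v \<in> carrier (Fob (?E S) p)"
    then show "Comp PM A (?E F) (?E S) (Fmor (pullback P e) F S i) \<phi> p
          (Comp PM (?E S) (?E F) A \<psi> (Fmor (pullback P e) S F f) p v) \<oplus>\<^bsub>Fob (?E S) p\<^esub>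
        Comp PM B (?E G) (?E S) (Fmor (pullback P e) G S j) \<phi>' p
          (Comp PM (?E S) (?E G) B \<psi>' (Fmor (pullback P e) S G g) p v) = v"
      by (simp add: pullback_Fmor closed e_Field eqs \<phi>\<psi> \<phi>\<psi>')
  qed (auto intro!: comp_in_hom pullback_hom[OF i, unfolded pullback_Fmor]
      pullback_hom[OF j, unfolded pullback_Fmor] pullback_hom[OF f, unfolded pullback_Fmor]
      pullback_hom[OF g, unfolded pullback_Fmor] \<phi> \<psi> \<phi>' \<psi>' AO BO pullback_obj SO
      simp: pullback_Fmor closed e_Field eqs \<phi>\<psi> \<phi>\<psi>' \<psi>\<phi> \<psi>\<phi>'
        vect_hom_zero[OF hom_lin[OF \<psi>, simplified] obj_vs[OF FO, simplified] obj_vs[OF AO]]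
        vect_hom_zero[OF hom_lin[OF \<psi>', simplified] obj_vs[OF GO, simplified] obj_vs[OF BO]])
  then show ?thesis using pullback_in_ess_image[OF S] by (rule bexI)
qed

lemma ess_image_full_abelian:
  assumes inf: "infinite (UNIV :: 'v set)"
  shows "full_abelian_subcategory PM (ess_image :: ('p, 'k, 'v) pers_module set)"
proof -
  let ?C = "PM :: (('p, 'k, 'v) pers_module, 'p \<Rightarrow> 'v \<Rightarrow> 'v) add_cat"
  let ?I = "ess_image :: ('p, 'k, 'v) pers_module set"
  have sub: "?I \<subseteq> Obj ?C" by (auto simp: essential_image_def)
  have "additive_category (full_subcategory ?C ?I)"
  proof (rule additive_category.intro)
    show "preadditive_category (full_subcategory ?C ?I)"
      by (rule preadditive_full_subcategory[OF preadditive sub])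
    show "additive_category_axioms (full_subcategory ?C ?I)"
    proof (rule additive_category_axioms.intro)
      obtain Z :: "('q, 'k, 'v) pers_module" where Z: "Z \<in> pfd_modules K Q \<and>
        (\<forall>x \<in> Field Q. carrier (Fob Z x) = {\<zero>\<^bsub>Fob Z x\<^esub>})" using target.ex_zero_module by (rule exE)
      then have ZI: "Fob (pullback P e) Z \<in> ess_image" by (intro pullback_in_ess_image) simp
      have "zero_object PM (Fob (pullback P e) Z)"
        by (rule zero_objectI) (use Z ZI sub e_Field in auto)
      \<comment> \<open>The subcategory has the same morphisms and fewer objects to test
        against.\<close>
      then have "zero_object (full_subcategory ?C ?I) (Fob (pullback P e) Z)"
        unfolding zero_object_def full_subcategory_def using ZI subsetD[OF sub] by simp
      then show "\<exists>Z. zero_object (full_subcategory ?C ?I) Z" ..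
    next
      fix A B assume "A \<in> Obj (full_subcategory ?C ?I)" "B \<in> Obj (full_subcategory ?C ?I)"
      then have "A \<in> ?I" "B \<in> ?I" by (simp_all add: full_subcategory_def)
      then obtain S where "S \<in> ?I" "is_biproduct PM A B S" using ess_image_biproduct[OF inf] by metis
      then have "is_biproduct (full_subcategory ?C ?I) A B S"
        by (simp add: is_biproduct_def full_subcategory_def)
      then show "\<exists>S. is_biproduct (full_subcategory ?C ?I) A B S" ..
    qed
  qed
  note 1 = conjI[OF abelian[OF inf] conjI[OF sub conjI[OF this]]]
  show ?thesis
    unfolding full_abelian_subcategory_def by (intro 1 ballI ess_image_kernel_cokernel)
qed

end

section \<open>Refining encoding maps to connected fibers\<close>

text \<open>De Morgan: an intersection is the complement of a finite union of complements. Cutting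
  down to \<open>Field P\<close> gives the empty family the value \<open>Field P\<close>.\<close>

lemma encoding_structure_Inter:
  assumes "encoding_structure P X" "finite I" "\<And>i. i \<in> I \<Longrightarrow> S i \<in> X"
  shows "{p \<in> Field P. \<forall>i \<in> I. p \<in> S i} \<in> X"
proof -
  have union: "\<Union>\<F> \<in> X" if "finite \<F>" "\<F> \<subseteq> X" for \<F>
    using assms(1) that by (simp add: encoding_structure_def)
  have compl: "Field P - S \<in> X" if "S \<in> X" for S
    using assms(1) that by (simp add: encoding_structure_def)
  have "(\<lambda>i. Field P - S i) ` I \<subseteq> X" using assms(3) compl by auto
  then have "\<Union> ((\<lambda>i. Field P - S i) ` I) \<in> X"
    using assms(2) by (intro union) simp_all
  then have "Field P - \<Union> ((\<lambda>i. Field P - S i) ` I) \<in> X"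
    by (rule compl)
  moreover have "Field P - \<Union> ((\<lambda>i. Field P - S i) ` I) = {p \<in> Field P. \<forall>i \<in> I. p \<in> S i}"
    by auto
  ultimately show ?thesis by simp
qed

locale poset_maps =
  fixes P :: "'p rel" and I :: "'i set" and R :: "'i \<Rightarrow> 'q rel" and f :: "'i \<Rightarrow> 'p \<Rightarrow> 'q"
  assumes P: "Partial_order P" and R: "\<And>i. i \<in> I \<Longrightarrow> Partial_order (R i)"
    and f: "\<And>i. i \<in> I \<Longrightarrow> poset_map P (R i) (f i)"
begin

text \<open>One move of a zigzag on which all \<open>f i\<close> keep their value. Its equivalence
  classes are described without mentioning a fiber; \<open>component_in_components\<close>
  identifies them with the connected components of the joint fibers.\<close>

definition "step = (P \<union> P\<inverse>) \<inter> {(x, y). \<forall>i \<in> I. f i x = f i y}"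

definition "fiber p = {q \<in> Field P. \<forall>i \<in> I. f i q = f i p}"

definition "component p = step\<^sup>* `` {p}"

lemma P_refl: "p \<in> Field P \<Longrightarrow> (p, p) \<in> P"
  using P by (auto simp: partial_order_on_def preorder_on_def refl_on_def)

lemma R_trans: "\<lbrakk>i \<in> I; (x, y) \<in> R i; (y, z) \<in> R i\<rbrakk> \<Longrightarrow> (x, z) \<in> R i"
  using R by (auto simp: partial_order_on_def preorder_on_def dest: transD)

lemma R_antisym: "\<lbrakk>i \<in> I; (x, y) \<in> R i; (y, x) \<in> R i\<rbrakk> \<Longrightarrow> x = y"
  using R by (auto simp: partial_order_on_def dest: antisymD)

lemma f_mono: "i \<in> I \<Longrightarrow> (p, q) \<in> P \<Longrightarrow> (f i p, f i q) \<in> R i"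
  and f_Field: "i \<in> I \<Longrightarrow> p \<in> Field P \<Longrightarrow> f i p \<in> Field (R i)"
  using f by (auto simp: poset_map_def)

lemma component_eq_iff: "component p = component q \<longleftrightarrow> (p, q) \<in> step\<^sup>*"
proof -
  have "sym step" by (auto simp: sym_def step_def)
  then have "sym (step\<^sup>*)" by (rule sym_rtrancl)
  then show ?thesis
    unfolding component_def by (auto dest: symD rtrancl_trans)
qed

lemma component_f:
  assumes "component p = component q" "i \<in> I"
  shows "f i p = f i q"
  using assms(1) unfolding component_eq_iff
  by (induction) (use assms(2) in \<open>auto simp: step_def\<close>)

lemma component_comparable:
  assumes "(p, q) \<in> P" "\<And>i. i \<in> I \<Longrightarrow> f i p = f i q"
  shows "component p = component q"
  using assms unfolding component_eq_iff step_def by auto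

lemma component_path:
  assumes "component p = component q"
  shows "(p, q) \<in> ((P \<union> P\<inverse>) \<inter> {(x, y). component x = component y})\<^sup>*"
proof (rule rtrancl_mono[THEN subsetD])
  show "step \<subseteq> (P \<union> P\<inverse>) \<inter> {(x, y). component x = component y}"
    using component_eq_iff by (auto simp: step_def)
  show "(p, q) \<in> step\<^sup>*" using assms by (simp add: component_eq_iff)
qed

text \<open>Monotonicity gives the reverse inequality for each \<open>f i\<close>, so antisymmetry
  of \<open>R i\<close> puts the comparable elements \<open>p\<close> and \<open>q\<close> into one
  fiber. This is how antisymmetry passes from the \<open>R i\<close> to the order on
  components.\<close>

lemma component_antisym:
  assumes "(p, q) \<in> P" and qp: "\<And>i. i \<in> I \<Longrightarrow> (f i q, f i p) \<in> R i"
  shows "component p = component q"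
  using assms(1) by (rule component_comparable) (use R_antisym f_mono assms in blast)

text \<open>A path of \<open>step\<close> starting at \<open>p\<close> never changes a value
  \<open>f i\<close>, so it stays in \<open>fiber p\<close>, and reachability there is the zigzag
  relation of that fiber.\<close>

lemma component_in_components:
  assumes p: "p \<in> Field P"
  shows "component p \<in> connected_components_of_poset P (fiber p)"
proof -
  have *: "q \<in> fiber p \<and> (p, q) \<in> ((P \<union> P\<inverse>) \<inter> fiber p \<times> fiber p)\<^sup>*" if "(p, q) \<in> step\<^sup>*" for q
    using that
  proof induction
    case (step y z)
    then have "(y, z) \<in> (P \<union> P\<inverse>) \<inter> fiber p \<times> fiber p"
      by (auto simp: step_def fiber_def FieldI1 FieldI2)
    then show ?case using rtrancl_into_rtrancl[OF conjunct2[OF step.IH]] by blast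
  qed (use p in \<open>simp add: fiber_def\<close>)
  have sub: "((P \<union> P\<inverse>) \<inter> fiber p \<times> fiber p)\<^sup>* \<subseteq> step\<^sup>*"
    by (rule rtrancl_mono) (auto simp: step_def fiber_def)
  have pp: "p \<in> fiber p" using p by (simp add: fiber_def)
  have "component p = zigzag_rel P (fiber p) `` {p}"
  proof (intro equalityI subsetI)
    fix q assume "q \<in> component p"
    then show "q \<in> zigzag_rel P (fiber p) `` {p}"
      using *[of q] pp by (simp add: component_def zigzag_rel_def)
  next
    fix q assume "q \<in> zigzag_rel P (fiber p) `` {p}"
    then show "q \<in> component p"
      using subsetD[OF sub, of "(p, q)"] by (simp add: component_def zigzag_rel_def)
  qed
  then show ?thesis
    unfolding connected_components_of_poset_def using quotientI[OF pp] by simp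
qed

text \<open>An element between two elements of the fiber has its values \<open>f i\<close> squeezed
  between equal ones.\<close>

lemma fiber_interval: "interval_in P (fiber p)"
  unfolding interval_in_def
proof (intro conjI ballI allI impI)
  fix q q' r assume *: "q \<in> fiber p" "q' \<in> fiber p" "(q, r) \<in> P \<and> (r, q') \<in> P"
  have "f i r = f i p" if i: "i \<in> I" for i
    using R_antisym[OF i] f_mono[OF i] * i unfolding fiber_def by (metis (mono_tags, lifting) mem_Collect_eq)
  then show "r \<in> fiber p" using * by (auto simp: fiber_def FieldI1)
qed (auto simp: fiber_def)

lemma fiber_in:
  assumes "encoding_structure P X" "finite I"
    and "\<And>i x. i \<in> I \<Longrightarrow> x \<in> Field (R i) \<Longrightarrow> {p \<in> Field P. f i p = x} \<in> X" and p: "p \<in> Field P"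
  shows "fiber p \<in> X"
proof -
  have "{q \<in> Field P. \<forall>i \<in> I. q \<in> {q \<in> Field P. f i q = f i p}} \<in> X"
    by (rule encoding_structure_Inter[OF assms(1,2)]) (use assms(3) f_Field p in auto)
  moreover have "{q \<in> Field P. \<forall>i \<in> I. q \<in> {q \<in> Field P. f i q = f i p}} = fiber p"
    by (auto simp: fiber_def)
  ultimately show ?thesis by simp
qed

text \<open>A fiber is determined by its tuple of values, and the tuples range over a finite product
  of finite sets.\<close>

lemma finite_fibers:
  assumes "finite I" "\<And>i. i \<in> I \<Longrightarrow> finite (Field (R i))"
  shows "finite (fiber ` Field P)"
proof -
  have "fiber ` Field P \<subseteq> (\<lambda>h. {q \<in> Field P. \<forall>i \<in> I. f i q = h i}) ` (\<Pi>\<^sub>E i \<in> I. Field (R i))"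
  proof
    fix S assume "S \<in> fiber ` Field P"
    then obtain p where p: "p \<in> Field P" "S = fiber p" by auto
    then show "S \<in> (\<lambda>h. {q \<in> Field P. \<forall>i \<in> I. f i q = h i}) ` (\<Pi>\<^sub>E i \<in> I. Field (R i))"
      by (intro image_eqI[of _ _ "\<lambda>i \<in> I. f i p"]) (auto simp: fiber_def f_Field)
  qed
  moreover have "finite (\<Pi>\<^sub>E i \<in> I. Field (R i))" using assms by (intro finite_PiE)
  ultimately show ?thesis by (meson finite_imageI finite_subset)
qed

text \<open>This is where connectivity of \<open>X\<close> enters: each of the finitely many joint
  fibers is an interval in \<open>X\<close>, so it contributes finitely many components, all in
  \<open>X\<close>.\<close>

lemma finite_components:
  assumes "encoding_structure P X" "connective P X" "finite I" "\<And>i. i \<in> I \<Longrightarrow> finite (Field (R i))"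
    and "\<And>i x. i \<in> I \<Longrightarrow> x \<in> Field (R i) \<Longrightarrow> {p \<in> Field P. f i p = x} \<in> X"
  shows "finite (component ` Field P)" and "component ` Field P \<subseteq> X"
proof -
  have *: "finite (connected_components_of_poset P (fiber p)) \<and> connected_components_of_poset P (fiber p) \<subseteq> X"
    if "p \<in> Field P" for p
    using assms(2) fiber_in[OF assms(1,3,5) that] fiber_interval[of p] unfolding connective_def by blast
  have "component ` Field P \<subseteq> \<Union> (connected_components_of_poset P ` fiber ` Field P)"
    using component_in_components by auto
  moreover have "finite (\<Union> (connected_components_of_poset P ` fiber ` Field P))"
    by (rule finite_Union) (use finite_fibers[OF assms(3,4)] * in auto)
  ultimately show "finite (component ` Field P)" by (rule finite_subset)
  show "component ` Field P \<subseteq> X" using * component_in_components by blast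
qed

section \<open>The order generated on the components, for any labelling \<open>e\<close> of
  them\<close>

context
  fixes e :: "'p \<Rightarrow> 'c"
  assumes e: "\<And>p q. p \<in> Field P \<Longrightarrow> q \<in> Field P \<Longrightarrow> e p = e q \<longleftrightarrow> component p = component q"
begin

text \<open>The transitive closure without the reflexive one: loops at points \<open>e p\<close>
  come from reflexivity of \<open>P\<close>, while a reflexive closure would enlarge the field to
  the whole type \<open>'c\<close>, and finiteness of the target would be lost for naturals.\<close>

definition "quotient_order = ((\<lambda>(p, q). (e p, e q)) ` P)\<^sup>+"

text \<open>Along each generating pair \<open>f i\<close> is monotone, and moving between
  representatives of one component leaves it unchanged. The inequalities therefore chain, and they
  hold for all representatives of the end points.\<close>

lemma quotient_order_f:
  assumes "(x, y) \<in> quotient_order" and i: "i \<in> I"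
    and p: "p \<in> Field P" "e p = x" and "q \<in> Field P" "e q = y"
  shows "(f i p, f i q) \<in> R i"
  using assms(1) \<open>q \<in> Field P\<close> \<open>e q = y\<close> unfolding quotient_order_def
proof (induction arbitrary: q)
  case (base y)
  then obtain p' q' where "(p', q') \<in> P" "e p' = x" "e q' = y" by auto
  then have "f i p' = f i p" "f i q' = f i q" "(f i p', f i q') \<in> R i"
    using base p e component_f[OF _ i] f_mono[OF i] by (metis FieldI1, metis FieldI2, metis)
  then show ?case by simp
next
  case (step y z)
  then obtain p' q' where *: "(p', q') \<in> P" "e p' = y" "e q' = z" by auto
  then have "(f i p, f i p') \<in> R i" using step.IH by (simp add: FieldI1)
  moreover have "f i q' = f i q" "(f i p', f i q') \<in> R i"
    using * step p e component_f[OF _ i] f_mono[OF i] by (metis FieldI2, metis)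
  ultimately show ?case using R_trans[OF i] by simp
qed

lemma Field_quotient_order: "Field quotient_order = e ` Field P"
proof -
  have "Field ((\<lambda>(p, q). (e p, e q)) ` P) = e ` Field P"
    by (fastforce simp: Field_def Domain_iff Range_iff image_iff)
  then show ?thesis by (simp add: quotient_order_def Field_def)
qed

text \<open>Antisymmetric because the order generated on components is compatible with all \<open>f i\<close>, so a cycle
  stays inside one fiber.\<close>

lemma quotient_order_partial_order: "Partial_order quotient_order"
  unfolding partial_order_on_def preorder_on_def
proof (intro conjI)
  show "trans quotient_order" by (simp add: quotient_order_def)
  show "quotient_order \<subseteq> Field quotient_order \<times> Field quotient_order" by (auto simp: FieldI1 FieldI2)
  show "refl_on (Field quotient_order) quotient_order"
    unfolding Field_quotient_order
  proof (rule refl_onI)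
    fix x assume "x \<in> e ` Field P"
    then show "(x, x) \<in> quotient_order"
      using P_refl unfolding quotient_order_def by force
  qed
  \<comment> \<open>One generating pair lying on a cycle is collapsed first; longer cycles are then
    collapsed one pair at a time.\<close>
  have gen: "x = y" if xy: "(x, y) \<in> (\<lambda>(p, q). (e p, e q)) ` P" and yx: "(y, x) \<in> quotient_order" for x y
  proof -
    obtain p q where pq: "(p, q) \<in> P" "x = e p" "y = e q" using xy by auto
    have "p \<in> Field P" "q \<in> Field P" using pq by (auto simp: FieldI1 FieldI2)
    moreover have "component p = component q"
      using pq(1) by (rule component_antisym) (use quotient_order_f[OF yx] pq in \<open>auto simp: FieldI1 FieldI2\<close>)
    ultimately show ?thesis using e pq by simp
  qed
  show "antisym quotient_order"
  proof (rule antisymI)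
    fix x y assume "(x, y) \<in> quotient_order" "(y, x) \<in> quotient_order"
    then show "x = y"
      unfolding quotient_order_def
    proof induction
      case (base y)
      then show ?case using gen by (simp add: quotient_order_def)
    next
      case (step y z)
      \<comment> \<open>On the cycle through \<open>x\<close>, \<open>y\<close> and
        \<open>z\<close>, the way from \<open>z\<close> over \<open>x\<close> to \<open>y\<close>
        closes the last pair, and the way from \<open>y\<close> over \<open>z\<close> to
        \<open>x\<close> is what the induction hypothesis asks for.\<close>
      have "(z, y) \<in> quotient_order" "(y, x) \<in> quotient_order"
        using step unfolding quotient_order_def by (auto intro: trancl_trans)
      then show ?case using step gen unfolding quotient_order_def by metis
    qed
  qed
qed

lemma quotient_poset_map: "poset_map P quotient_order e"
  unfolding poset_map_def Field_quotient_order by (auto simp: quotient_order_def intro!: r_into_trancl')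

text \<open>The factor of \<open>f i\<close> through \<open>e\<close>: a label is sent to the value
  of \<open>f i\<close> at any element of its component. Along it a module over \<open>R i\<close>
  is restricted to the components.\<close>

lemma quotient_factor_map:
  assumes i: "i \<in> I"
  shows "poset_map quotient_order (R i) (\<lambda>x. f i (inv_into (Field P) e x))"
  unfolding poset_map_def Field_quotient_order
proof (intro conjI allI impI)
  show "(\<lambda>x. f i (inv_into (Field P) e x)) \<in> e ` Field P \<rightarrow> Field (R i)"
    using f_Field[OF i] by (auto simp: inv_into_into)
  fix x y assume xy: "(x, y) \<in> quotient_order"
  then have "x \<in> e ` Field P" "y \<in> e ` Field P"
    using Field_quotient_order by (auto simp: FieldI1 FieldI2)
  then show "(f i (inv_into (Field P) e x), f i (inv_into (Field P) e y)) \<in> R i"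
    by (intro quotient_order_f[OF xy i]) (simp_all add: inv_into_into f_inv_into_f)
qed

lemma quotient_factor:
  assumes i: "i \<in> I" and p: "p \<in> Field P"
  shows "f i (inv_into (Field P) e (e p)) = f i p"
proof (rule component_f[OF _ i])
  show "component (inv_into (Field P) e (e p)) = component p"
    using e[of "inv_into (Field P) e (e p)" p] p by (simp add: inv_into_into f_inv_into_f)
qed

lemma quotient_fiber:
  assumes "p \<in> Field P"
  shows "{q \<in> Field P. e q = e p} = component p"
proof -
  have "component p \<subseteq> Field P"
  proof
    fix q assume "q \<in> component p"
    then have "(p, q) \<in> step\<^sup>*" by (simp add: component_def)
    then show "q \<in> Field P"
      by induction (use assms in \<open>auto simp: step_def FieldI1 FieldI2\<close>)
  qed
  moreover have "q \<in> component p \<longleftrightarrow> component q = component p" for q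
    using component_eq_iff[of p q] by (auto simp: component_def)
  ultimately show ?thesis using e assms by auto
qed

end

end

section \<open>Assembly of the common encoding map\<close>

theorem proposition3p5:
  fixes K :: "('k, 'r) ring_scheme"
    and P :: "'p rel"
    and X :: "'p set set"
    and M :: "nat \<Rightarrow> ('p, 'k, 'v) pers_module"
    and n :: nat
  assumes "field K"
    and "infinite (UNIV :: 'v set)"
    and "Partial_order P"
    and "encoding_structure P X"
    and "connective P X"
    and "\<forall>i \<le> n. M i \<in> encodable_modules K P X"
  shows "\<exists>(P' :: nat rel) (e :: 'p \<Rightarrow> nat).
    (\<forall>i \<le> n. encoding_map K P X (M i) P' e) \<and>
    fully_faithful
      (pers_category K P' :: ((nat, 'k, 'v) pers_module, nat \<Rightarrow> 'v \<Rightarrow> 'v) add_cat)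
      (pers_category K P) (pullback P e) \<and>
    (let \<I> = essential_image (pers_category K P) (pullback P e)
               (pfd_modules K P' :: (nat, 'k, 'v) pers_module set)
     in full_abelian_subcategory (pers_category K P) \<I> \<and>
        (\<forall>i \<le> n. M i \<in> \<I>) \<and>
        \<I> \<subseteq> encodable_modules K P X)"
proof -
  have "\<forall>i. \<exists>R f. i \<le> n \<longrightarrow> encoding_map K P X (M i) (R :: nat rel) f"
    using assms(6) by (auto simp: encodable_modules_def)
  then obtain R f where enc: "\<And>i. i \<le> n \<Longrightarrow> encoding_map K P X (M i) (R i :: nat rel) (f i)"
    by metis
  have M: "M i \<in> Obj (pers_category K P)" if "i \<le> n" for i
    using assms(6) that by (auto simp: encodable_modules_def)
  interpret poset_maps P "{..n}" R f
    by unfold_locales (use assms(3) enc in \<open>auto simp: encoding_map_def\<close>)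
  have fin: "finite (component ` Field P)" and comp_X: "component ` Field P \<subseteq> X"
    using finite_components[OF assms(4,5)] enc by (auto simp: encoding_map_def)
  \<comment> \<open>Components are sets of elements of \<open>P\<close>; being finitely many they
    can be numbered, which yields a target poset on naturals.\<close>
  obtain code :: "'p set \<Rightarrow> nat" where code: "inj_on code (component ` Field P)"
    using finite_imp_inj_to_nat_seg[OF fin] by blast
  define e where "e = code \<circ> component"
  have e: "e p = e q \<longleftrightarrow> component p = component q" if "p \<in> Field P" "q \<in> Field P" for p q
    using inj_on_eq_iff[OF code] that by (simp add: e_def)
  define Q where "Q = quotient_order e"
  have Q: "Partial_order Q" "poset_map P Q e" "Field Q = e ` Field P"
    unfolding Q_def using quotient_order_partial_order[OF e] quotient_poset_map[OF e]
      Field_quotient_order[OF e] by blast+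
  interpret connected_quotient K P Q e
  proof (intro connected_quotient.intro persistence_pullback.intro persistence.intro
      persistence_pullback_axioms.intro connected_quotient_axioms.intro assms(1,3) Q(1,2))
    fix p q assume pq: "p \<in> Field P" "q \<in> Field P" "e p = e q"
    have "(P \<union> P\<inverse>) \<inter> {(x, y). component x = component y} \<subseteq> (P \<union> P\<inverse>) \<inter> {(x, y). e x = e y}"
      by (auto simp: e_def)
    then show "(p, q) \<in> ((P \<union> P\<inverse>) \<inter> {(x, y). e x = e y})\<^sup>*"
      using component_path[of p q] e pq rtrancl_mono by blast
  qed (simp_all add: Q(3), simp add: Q_def quotient_order_def[OF e])
  have fibers: "{p \<in> Field P. e p = x} \<in> X" if "x \<in> Field Q" for x
    using that quotient_fiber[OF e] comp_X unfolding Q(3) by force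
  have fin_Q: "finite (Field Q)"
    unfolding Q(3) e_def using fin by (simp flip: image_image image_comp)
  \<comment> \<open>The poset conditions on \<open>e\<close> do not depend on the module, so being
    isomorphic to a suitable pullback is all that remains to check for objects of the essential
    image, the \<open>M i\<close> among them.\<close>
  have enc_e: "encoding_map K P X A Q e"
    if "N \<in> pfd_modules K Q" "isomorphic PM A (Fob (pullback P e) N)" for A :: "('p, 'k, 'v) pers_module" and N
    using that Q(1,2) fin_Q fibers unfolding encoding_map_def by blast
  have image: "M i \<in> ess_image" if i: "i \<le> n" for i
  proof -
    obtain M' where M': "M' \<in> pfd_modules K (R i)" "isomorphic PM (M i) (Fob (pullback P (f i)) M')"
      using enc[OF i] unfolding encoding_map_def by blast
    \<comment> \<open>On \<open>Field P\<close> the map \<open>f i\<close> is \<open>?g\<close>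
      after \<open>e\<close>, so restricting \<open>M'\<close> along \<open>?g\<close> gives a
      module over \<open>Q\<close> whose pullback is isomorphic to \<open>M i\<close>.\<close>
    let ?g = "\<lambda>x. f i (inv_into (Field P) e x)"
    have Ri: "Partial_order (R i)" "poset_map P (R i) (f i)" "poset_map Q (R i) ?g"
      using enc[OF i] quotient_factor_map[OF e] i by (auto simp: encoding_map_def Q_def)
    note intros = persistence_pullback.intro persistence.intro persistence_pullback_axioms.intro
    interpret f: persistence_pullback K P "R i" "f i"
      by (intro intros assms(1,3) Ri)
    interpret g: persistence_pullback K Q "R i" ?g
      by (intro intros assms(1) Q(1) Ri)
    have N: "Fob (pullback Q ?g) M' \<in> pfd_modules K Q" by (rule g.pullback_pfd[OF M'(1)])
    have "isomorphic PM (M i) (Fob (pullback P e) (Fob (pullback Q ?g) M'))"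
    proof (rule isomorphic_cong[OF M'(2) M[OF i]])
      show "Fob (pullback P (f i)) M' \<in> Obj PM"
        using M'(1) by (intro f.pullback_obj) (simp add: pfd_modules_def)
      show "Fob (pullback P e) (Fob (pullback Q ?g) M') \<in> Obj PM"
        using N by (intro pullback_obj) (simp add: pfd_modules_def)
    qed (use i quotient_factor[OF e] in \<open>auto simp: FieldI1 FieldI2\<close>)
    then show ?thesis using N M[OF i] by (auto simp: essential_image_def)
  qed
  have enc_image: "\<exists>N \<in> pfd_modules K Q. isomorphic PM A (Fob (pullback P e) N)"
    if "A \<in> ess_image" for A :: "('p, 'k, 'v) pers_module"
    using that by (simp add: essential_image_def)
  have "encoding_map K P X A Q e" if "A \<in> ess_image" for A :: "('p, 'k, 'v) pers_module"
    using enc_image[OF that] enc_e by blast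
  moreover have "(ess_image :: ('p, 'k, 'v) pers_module set) \<subseteq> encodable_modules K P X"
    using calculation unfolding encodable_modules_def essential_image_def by blast
  ultimately show ?thesis
    unfolding Let_def
    using pullback_fully_faithful ess_image_full_abelian[OF assms(2)] image
    by (intro exI[of _ Q] exI[of _ e] conjI allI impI) simp_all
qed

end
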